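(* Fix the number of awards $n$. For $k$ agents, let $p_{i,k}$ denote the winning probability of agent $i$ (the $i$-th ranked agent) in a subgame perfect equilibrium of the $k$-agent competitive secretary game with deferred selections and ranked tie-breaking, and let $q_i$ denote the probability that agent $i$ receives the highest award in the subgame perfect equilibrium of the immediate-selection game with ranked tie-breaking (both defined in the context; $q_i$ does not depend on $k$). Then for every $i$, $\lim_{k\to\infty} p_{i,k}=q_i$.
   Context: Deferred-selection game: $n$ non-negative real awards are revealed one per time step in a uniformly random order ($v_t$ at time $t$). There are $k$ agents with a fixed global ranking $1,2,\dots,k$ (agent 1 highest). Upon the revelation of $v_t$, every agent without an award (active) may select any not-yet-assigned award among $v_1,\dots,v_t$, or pass; an award selected by several agents goes to the highest-ranked among them; agents receiving an award become inactive; if active agents remain after time $n$, they continue competing over the remaining available awards. Agent $i$ wins if she receives the highest allocated award; agents rank outcomes by the lexicographic order on the vector of probabilities of receiving the 1st, 2nd, ... highest allocated award, and a subgame perfect equilibrium is a profile that is a Nash equilibrium in every subgame. Immediate-selection game: same arrival process and ranking, but at time $t$ each active agent may only accept or reject the current award $v_t$, immediately and irrevocably; if several agents accept it, it goes to the highest-ranked of them, who then leaves. Each agent wishes to maximize the probability of receiving the highest award; $q_i$ is this probability for agent $i$ in the subgame perfect equilibrium of this game. *)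

theory Defs
  imports Complex_Main "HOL-Combinatorics.Permutations"
begin

(* ---------------------------------------------------------------------
   Common conventions.
   Awards are indexed by their arrival time s < n.  Only the relative order
   of the awards matters; an arrival order of n distinct awards is modelled
   by a permutation pi of {..<n}: pi s is the rank (0 = lowest, n-1 = highest)
   of the award revealed at time s.  The uniformly random order is the uniform
   distribution on these permutations.
   Agents are 1..k; a smaller index means a higher global rank.
   At round t the agents observe the relative order of the awards revealed so
   far (awards 0..t) and all previous (effective) actions.
   --------------------------------------------------------------------- *)

definition perms :: "nat \<Rightarrow> (nat \<Rightarrow> nat) set" where
  "perms n = {\<pi>. \<pi> permutes {..<n}}"

definition obs :: "nat \<Rightarrow> (nat \<Rightarrow> nat) \<Rightarrow> nat \<Rightarrow> (nat \<times> nat) set" where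
  "obs n \<pi> t = {(s, s'). s \<le> t \<and> s' \<le> t \<and> s < n \<and> s' < n \<and> \<pi> s < \<pi> s'}"

definition cond :: "nat \<Rightarrow> (nat \<Rightarrow> nat) \<Rightarrow> nat \<Rightarrow> (nat \<Rightarrow> nat) set" where
  "cond n \<pi> t = {\<pi>' \<in> perms n. obs n \<pi>' t = obs n \<pi> t}"

definition lex_less :: "nat \<Rightarrow> (nat \<Rightarrow> real) \<Rightarrow> (nat \<Rightarrow> real) \<Rightarrow> bool" where
  "lex_less n f g \<longleftrightarrow> (\<exists>m\<in>{1..n}. (\<forall>l\<in>{1..<m}. f l = g l) \<and> f m < g m)"

(* action: None = pass, Some j = select award j *)
type_synonym d_jact = "nat \<Rightarrow> nat option"
type_synonym d_strategy = "(nat \<times> nat) set \<Rightarrow> d_jact list \<Rightarrow> nat option"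

(* allocation: agent \<mapsto> award received (None = still active) *)
definition d_step :: "nat \<Rightarrow> nat \<Rightarrow> nat \<Rightarrow> (nat \<Rightarrow> nat option) \<Rightarrow> d_jact \<Rightarrow> (nat \<Rightarrow> nat option)" where
  "d_step n k t al a = (\<lambda>i. if al i \<noteq> None then al i else
     (case a i of None \<Rightarrow> None | Some j \<Rightarrow>
       if 1 \<le> i \<and> i \<le> k \<and> j < n \<and> j \<le> t \<and> (\<forall>i'. al i' \<noteq> Some j)
          \<and> (\<forall>i'. 1 \<le> i' \<and> i' < i \<longrightarrow> al i' \<noteq> None \<or> a i' \<noteq> Some j)
       then Some j else None))"

definition d_alloc :: "nat \<Rightarrow> nat \<Rightarrow> d_jact list \<Rightarrow> (nat \<Rightarrow> nat option)" where
  "d_alloc n k acts = foldl (\<lambda>al (t, a). d_step n k t al a) (\<lambda>_. None) (zip [0..<length acts] acts)"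

definition d_mask :: "nat \<Rightarrow> nat \<Rightarrow> d_jact list \<Rightarrow> d_jact \<Rightarrow> d_jact" where
  "d_mask n k h a = (\<lambda>i. if 1 \<le> i \<and> i \<le> k \<and> d_alloc n k h i = None then a i else None)"

fun d_ext :: "nat \<Rightarrow> nat \<Rightarrow> (nat \<Rightarrow> d_strategy) \<Rightarrow> (nat \<Rightarrow> nat) \<Rightarrow> d_jact list \<Rightarrow> nat \<Rightarrow> d_jact list" where
  "d_ext n k \<sigma> \<pi> acts 0 = acts"
| "d_ext n k \<sigma> \<pi> acts (Suc m) =
     (let h = d_ext n k \<sigma> \<pi> acts m in h @ [d_mask n k h (\<lambda>i. \<sigma> i (obs n \<pi> (length h)) h)])"

(* rounds 0..n-1 reveal the awards; rounds n..n+k-1 let remaining active agents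
   keep competing over the remaining available awards *)
definition d_final :: "nat \<Rightarrow> nat \<Rightarrow> (nat \<Rightarrow> d_strategy) \<Rightarrow> (nat \<Rightarrow> nat) \<Rightarrow> d_jact list \<Rightarrow> (nat \<Rightarrow> nat option)" where
  "d_final n k \<sigma> \<pi> acts = d_alloc n k (d_ext n k \<sigma> \<pi> acts (n + k - length acts))"

definition d_rank :: "nat \<Rightarrow> (nat \<Rightarrow> nat) \<Rightarrow> (nat \<Rightarrow> nat option) \<Rightarrow> nat \<Rightarrow> nat" where
  "d_rank k \<pi> al i = (case al i of None \<Rightarrow> 0 | Some j \<Rightarrow>
      Suc (card {i'. 1 \<le> i' \<and> i' \<le> k \<and> (\<exists>j'. al i' = Some j' \<and> \<pi> j < \<pi> j')}))"

(* vector of probabilities of receiving the m-th highest allocated award in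
   the subgame after history acts (round length acts, observation from pi) *)
definition d_pay :: "nat \<Rightarrow> nat \<Rightarrow> (nat \<Rightarrow> d_strategy) \<Rightarrow> (nat \<Rightarrow> nat) \<Rightarrow> d_jact list \<Rightarrow> nat \<Rightarrow> nat \<Rightarrow> real" where
  "d_pay n k \<sigma> \<pi> acts i m =
     real (card {\<pi>' \<in> cond n \<pi> (length acts). d_rank k \<pi>' (d_final n k \<sigma> \<pi>' acts) i = m})
     / real (card (cond n \<pi> (length acts)))"

definition d_valid :: "nat \<Rightarrow> nat \<Rightarrow> d_jact list \<Rightarrow> bool" where
  "d_valid n k acts \<longleftrightarrow> length acts < n + k \<and>
     (\<forall>l < length acts. acts ! l = d_mask n k (take l acts) (acts ! l))"

definition d_spe :: "nat \<Rightarrow> nat \<Rightarrow> (nat \<Rightarrow> d_strategy) \<Rightarrow> bool" where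
  "d_spe n k \<sigma> \<longleftrightarrow> (\<forall>\<pi> \<in> perms n. \<forall>acts. d_valid n k acts \<longrightarrow>
     (\<forall>i\<in>{1..k}. \<forall>\<tau>. \<not> lex_less n (d_pay n k \<sigma> \<pi> acts i) (d_pay n k (\<sigma>(i := \<tau>)) \<pi> acts i)))"

definition d_win :: "nat \<Rightarrow> nat \<Rightarrow> (nat \<Rightarrow> d_strategy) \<Rightarrow> nat \<Rightarrow> real" where
  "d_win n k \<sigma> i = real (card {\<pi> \<in> perms n. d_rank k \<pi> (d_final n k \<sigma> \<pi> []) i = 1})
     / real (card (perms n))"

(* action: True = accept current award *)
type_synonym i_jact = "nat \<Rightarrow> bool"
type_synonym i_strategy = "(nat \<times> nat) set \<Rightarrow> i_jact list \<Rightarrow> bool"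

definition i_step :: "nat \<Rightarrow> nat \<Rightarrow> nat \<Rightarrow> (nat \<Rightarrow> nat option) \<Rightarrow> i_jact \<Rightarrow> (nat \<Rightarrow> nat option)" where
  "i_step n k t al a = (\<lambda>i. if al i \<noteq> None then al i else
       if 1 \<le> i \<and> i \<le> k \<and> t < n \<and> a i
          \<and> (\<forall>i'. 1 \<le> i' \<and> i' < i \<longrightarrow> al i' \<noteq> None \<or> \<not> a i')
       then Some t else None)"

definition i_alloc :: "nat \<Rightarrow> nat \<Rightarrow> i_jact list \<Rightarrow> (nat \<Rightarrow> nat option)" where
  "i_alloc n k acts = foldl (\<lambda>al (t, a). i_step n k t al a) (\<lambda>_. None) (zip [0..<length acts] acts)"

definition i_mask :: "nat \<Rightarrow> nat \<Rightarrow> i_jact list \<Rightarrow> i_jact \<Rightarrow> i_jact" where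
  "i_mask n k h a = (\<lambda>i. 1 \<le> i \<and> i \<le> k \<and> i_alloc n k h i = None \<and> a i)"

fun i_ext :: "nat \<Rightarrow> nat \<Rightarrow> (nat \<Rightarrow> i_strategy) \<Rightarrow> (nat \<Rightarrow> nat) \<Rightarrow> i_jact list \<Rightarrow> nat \<Rightarrow> i_jact list" where
  "i_ext n k \<sigma> \<pi> acts 0 = acts"
| "i_ext n k \<sigma> \<pi> acts (Suc m) =
     (let h = i_ext n k \<sigma> \<pi> acts m in h @ [i_mask n k h (\<lambda>i. \<sigma> i (obs n \<pi> (length h)) h)])"

definition i_final :: "nat \<Rightarrow> nat \<Rightarrow> (nat \<Rightarrow> i_strategy) \<Rightarrow> (nat \<Rightarrow> nat) \<Rightarrow> i_jact list \<Rightarrow> (nat \<Rightarrow> nat option)" where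
  "i_final n k \<sigma> \<pi> acts = i_alloc n k (i_ext n k \<sigma> \<pi> acts (n - length acts))"

definition i_wins :: "nat \<Rightarrow> (nat \<Rightarrow> nat) \<Rightarrow> (nat \<Rightarrow> nat option) \<Rightarrow> nat \<Rightarrow> bool" where
  "i_wins n \<pi> al i \<longleftrightarrow> (\<exists>j. al i = Some j \<and> \<pi> j = n - 1)"

definition i_pay :: "nat \<Rightarrow> nat \<Rightarrow> (nat \<Rightarrow> i_strategy) \<Rightarrow> (nat \<Rightarrow> nat) \<Rightarrow> i_jact list \<Rightarrow> nat \<Rightarrow> real" where
  "i_pay n k \<sigma> \<pi> acts i =
     real (card {\<pi>' \<in> cond n \<pi> (length acts). i_wins n \<pi>' (i_final n k \<sigma> \<pi>' acts) i})
     / real (card (cond n \<pi> (length acts)))"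

definition i_valid :: "nat \<Rightarrow> nat \<Rightarrow> i_jact list \<Rightarrow> bool" where
  "i_valid n k acts \<longleftrightarrow> length acts < n \<and>
     (\<forall>l < length acts. acts ! l = i_mask n k (take l acts) (acts ! l))"

definition i_spe :: "nat \<Rightarrow> nat \<Rightarrow> (nat \<Rightarrow> i_strategy) \<Rightarrow> bool" where
  "i_spe n k \<sigma> \<longleftrightarrow> (\<forall>\<pi> \<in> perms n. \<forall>acts. i_valid n k acts \<longrightarrow>
     (\<forall>i\<in>{1..k}. \<forall>\<tau>. i_pay n k (\<sigma>(i := \<tau>)) \<pi> acts i \<le> i_pay n k \<sigma> \<pi> acts i))"

(* q_i (computed in a game with k agents, k \<ge> i) *)
definition i_win :: "nat \<Rightarrow> nat \<Rightarrow> (nat \<Rightarrow> i_strategy) \<Rightarrow> nat \<Rightarrow> real" where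
  "i_win n k \<sigma> i = real (card {\<pi> \<in> perms n. i_wins n \<pi> (i_final n k \<sigma> \<pi> []) i})
     / real (card (perms n))"

end

theory Submission
  imports Defs
begin

text \<open>Let \<open>V\<^sub>t(r)\<close> be the winning probability, before award \<open>t\<close> is revealed, of an agent with \<open>r\<close> active
  agents ranked above her. If the award revealed at round \<open>t\<close> is the best so far, it wins with
  probability \<open>a = (t + 1) / n\<close>, and it goes to the first agent in the ranking whose continuation
  value does not exceed \<open>a\<close>; everybody below moves up one place. So the values at that moment are the
  decreasing sequence \<open>V\<^sub>t\<^sub>+\<^sub>1\<close> with \<open>a\<close> inserted, no matter how ties are broken, and this determines
  \<open>V\<^sub>t\<close> by backward recursion.

  Immediate selection obeys this recursion directly. With deferred selection, an untaken best
  award can always be secured by an active agent unless somebody else selects it; since the winning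
  probabilities sum to at most one, more than \<open>n\<close> active agents force the current best award to be
  taken at once. Leaving it on the table for one round only raises everybody's value, so a deviation
  to passing is at least as good as in the immediate game, and the equilibrium conditions again give
  the insertion rule. Hence \<open>p\<^sub>i\<^sub>,\<^sub>k = q\<^sub>i = V\<^sub>0(i - 1)\<close> as soon as \<open>k > 2n\<close>.\<close>

section \<open>Conditional expectations over arrival orders\<close>

text \<open>Conditional expectation given the observations at round \<open>t\<close>:
  \<open>cond n \<pi> t\<close> is the information class of \<open>\<pi>\<close> under the uniform
  random order.\<close>

definition expect :: "nat \<Rightarrow> (nat \<Rightarrow> nat) \<Rightarrow> nat \<Rightarrow> ((nat \<Rightarrow> nat) \<Rightarrow> real) \<Rightarrow> real" where
  "expect n \<pi> t f = (\<Sum>\<pi>'\<in>cond n \<pi> t. f \<pi>') / real (card (cond n \<pi> t))"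

text \<open>Recursion over rounds makes the dichotomy "new record or unchanged" available by
  unfolding; the one-round averages below split along it.\<close>

fun bst :: "(nat \<Rightarrow> nat) \<Rightarrow> nat \<Rightarrow> nat" where
  "bst \<pi> 0 = 0"
| "bst \<pi> (Suc t) = (if \<pi> (bst \<pi> t) < \<pi> (Suc t) then Suc t else bst \<pi> t)"

lemma finite_cond: "finite (cond n \<pi> t)"
proof -
  have "finite (perms n)"
    unfolding perms_def by (rule finite_permutations) simp
  then show ?thesis
    unfolding cond_def by simp
qed

lemma cond_subset_perms: "cond n \<pi> t \<subseteq> perms n"
  by (auto simp: cond_def)

lemma cond_self: "\<pi> \<in> perms n \<Longrightarrow> \<pi> \<in> cond n \<pi> t"
  by (simp add: cond_def)

lemma cond_eq: "\<pi>' \<in> cond n \<pi> t \<Longrightarrow> cond n \<pi>' t = cond n \<pi> t"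
  by (simp add: cond_def)

lemma card_cond_pos: "\<pi> \<in> perms n \<Longrightarrow> 0 < card (cond n \<pi> t)"
  unfolding card_gt_0_iff using cond_self[of \<pi> n t] finite_cond[of n \<pi> t] by blast

lemma obs_eq_Suc: "obs n \<pi>' (Suc t) = obs n \<pi> (Suc t) \<Longrightarrow> obs n \<pi>' t = obs n \<pi> t"
proof -
  assume eq: "obs n \<pi>' (Suc t) = obs n \<pi> (Suc t)"
  have "obs n \<rho> t = obs n \<rho> (Suc t) \<inter> {..t} \<times> {..t}" for \<rho>
    by (auto simp: obs_def)
  then show ?thesis
    using eq by simp
qed

lemma cond_Suc: "cond n \<pi> (Suc t) \<subseteq> cond n \<pi> t"
  unfolding cond_def using obs_eq_Suc by blast

lemma cond_less_iff:
  assumes "\<pi>' \<in> cond n \<pi> t" "s \<le> t" "s' \<le> t" "t < n"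
  shows "\<pi>' s < \<pi>' s' \<longleftrightarrow> \<pi> s < \<pi> s'"
proof -
  have "obs n \<pi>' t = obs n \<pi> t"
    using assms(1) by (simp add: cond_def)
  moreover have "(s, s') \<in> obs n \<rho> t \<longleftrightarrow> \<rho> s < \<rho> s'" for \<rho>
    using assms by (auto simp: obs_def)
  ultimately show ?thesis
    by metis
qed

lemma perms_inj: "\<pi> \<in> perms n \<Longrightarrow> \<pi> s = \<pi> s' \<longleftrightarrow> s = s'"
  unfolding perms_def by (auto dest!: permutes_inj dest: injD)

lemma perms_less: "\<pi> \<in> perms n \<Longrightarrow> \<pi> s < n \<longleftrightarrow> s < n"
  using permutes_in_image[of \<pi> "{..<n}" s] by (simp add: perms_def)

lemma expect_cong:
  "(\<And>\<pi>'. \<pi>' \<in> cond n \<pi> t \<Longrightarrow> f \<pi>' = g \<pi>') \<Longrightarrow> expect n \<pi> t f = expect n \<pi> t g"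
  unfolding expect_def by (simp cong: sum.cong)

lemma expect_const: "\<pi> \<in> perms n \<Longrightarrow> expect n \<pi> t (\<lambda>_. c) = c"
  using card_cond_pos[of \<pi> n t] by (simp add: expect_def)

lemma expect_indicator:
  "expect n \<pi> t (\<lambda>\<pi>'. if Q \<pi>' then 1 else 0) =
    real (card {\<pi>' \<in> cond n \<pi> t. Q \<pi>'}) / real (card (cond n \<pi> t))"
  unfolding expect_def
  by (simp add: sum.If_cases[OF finite_cond] Int_def)

text \<open>The classes for round \<open>Suc t\<close> partition the class for round
  \<open>t\<close>. Adding up class averages over all members counts each \<open>f \<rho>'\<close>
  once per member of its class, which cancels the division by the class size.\<close>

lemma expect_tower:
  "expect n \<pi> t (\<lambda>\<pi>'. expect n \<pi>' (Suc t) f) = expect n \<pi> t f"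
proof -
  let ?C = "cond n \<pi> t"
  let ?c = "\<lambda>\<rho>. real (card (cond n \<rho> (Suc t)))"
  have sub: "cond n \<rho> (Suc t) \<subseteq> ?C" if "\<rho> \<in> ?C" for \<rho>
    using cond_Suc[of n \<rho> t] cond_eq[OF that] by simp
  have sym: "\<rho>' \<in> cond n \<rho> (Suc t) \<longleftrightarrow> \<rho> \<in> cond n \<rho>' (Suc t)" if "\<rho> \<in> ?C" "\<rho>' \<in> ?C" for \<rho> \<rho>'
    using that by (auto simp: cond_def)
  have "(\<Sum>\<rho>\<in>?C. expect n \<rho> (Suc t) f)
      = (\<Sum>\<rho>\<in>?C. \<Sum>\<rho>'\<in>{\<rho>'\<in>?C. \<rho>' \<in> cond n \<rho> (Suc t)}. f \<rho>' / ?c \<rho>)"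
  proof (rule sum.cong[OF refl])
    fix \<rho> assume "\<rho> \<in> ?C"
    then have "{\<rho>'\<in>?C. \<rho>' \<in> cond n \<rho> (Suc t)} = cond n \<rho> (Suc t)"
      using sub by auto
    then show "expect n \<rho> (Suc t) f = (\<Sum>\<rho>'\<in>{\<rho>'\<in>?C. \<rho>' \<in> cond n \<rho> (Suc t)}. f \<rho>' / ?c \<rho>)"
      by (simp add: expect_def sum_divide_distrib)
  qed
  also have "\<dots> = (\<Sum>\<rho>'\<in>?C. \<Sum>\<rho>\<in>{\<rho>\<in>?C. \<rho>' \<in> cond n \<rho> (Suc t)}. f \<rho>' / ?c \<rho>)"
    by (rule sum.swap_restrict[OF finite_cond finite_cond])
  also have "\<dots> = (\<Sum>\<rho>'\<in>?C. f \<rho>')"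
  proof (rule sum.cong[OF refl])
    fix \<rho>' assume \<rho>': "\<rho>' \<in> ?C"
    then have "{\<rho>\<in>?C. \<rho>' \<in> cond n \<rho> (Suc t)} = cond n \<rho>' (Suc t)"
      using sub sym by blast
    moreover have "?c \<rho> = ?c \<rho>'" if "\<rho> \<in> cond n \<rho>' (Suc t)" for \<rho>
      using cond_eq[OF that] by simp
    moreover have "?c \<rho>' > 0"
      using \<rho>' cond_subset_perms card_cond_pos by fastforce
    ultimately show "(\<Sum>\<rho>\<in>{\<rho>\<in>?C. \<rho>' \<in> cond n \<rho> (Suc t)}. f \<rho>' / ?c \<rho>) = f \<rho>'"
      by simp
  qed
  finally show ?thesis
    by (simp add: expect_def)
qed

section \<open>The best award so far and the law of records\<close>

lemma bst_le: "bst \<pi> t \<le> t"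
  by (induction t) auto

lemma bst_greatest: "s \<le> t \<Longrightarrow> \<pi> s \<le> \<pi> (bst \<pi> t)"
  by (induction t) (auto simp: le_Suc_eq)

lemma bst_eqI:
  assumes "\<pi> \<in> perms n" "b \<le> t" "\<And>s. s \<le> t \<Longrightarrow> \<pi> s \<le> \<pi> b"
  shows "bst \<pi> t = b"
proof -
  have "\<pi> (bst \<pi> t) = \<pi> b"
    using assms(3)[OF bst_le] bst_greatest[OF assms(2)] by (rule le_antisym)
  then show ?thesis
    using perms_inj[OF assms(1)] by simp
qed

lemma bst_cond:
  assumes "\<pi> \<in> perms n" "\<pi>' \<in> cond n \<pi> t" "t < n"
  shows "bst \<pi>' t = bst \<pi> t"
proof (rule bst_eqI)
  show "\<pi>' \<in> perms n" using assms cond_subset_perms by blast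
  show "bst \<pi> t \<le> t" by (rule bst_le)
  show "\<pi>' s \<le> \<pi>' (bst \<pi> t)" if "s \<le> t" for s
    using bst_greatest[OF that, of \<pi>] cond_less_iff[OF assms(2) bst_le that assms(3)]
    by (simp add: not_less[symmetric])
qed

lemma bst_last:
  assumes "\<pi> \<in> perms n" "0 < n"
  shows "\<pi> (bst \<pi> (n - 1)) = n - 1"
proof -
  have "\<pi> permutes {..<n}" using assms by (simp add: perms_def)
  then obtain s where s: "\<pi> s = n - 1"
    using permutes_surj surjD by metis
  then have "s < n"
    using perms_less[OF assms(1), of s] assms(2) by simp
  then have "n - 1 \<le> \<pi> (bst \<pi> (n - 1))"
    using bst_greatest[of s "n - 1" \<pi>] s by simp
  moreover have "\<pi> (bst \<pi> (n - 1)) < n"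
    using perms_less[OF assms(1)] bst_le[of \<pi> "n - 1"] assms(2)
    by (simp add: le_less_trans)
  ultimately show ?thesis
    by simp
qed

text \<open>The relative rank of the next award is uniform: swapping it with the award just above it
  maps the orders in which it has rank \<open>c\<close> bijectively to those in which it has rank \<open>c + 1\<close>.\<close>

lemma card_record:
  assumes "\<pi> \<in> perms n" "Suc t < n"
  shows "card (cond n \<pi> t) = (t + 2) * card {\<pi>' \<in> cond n \<pi> t. bst \<pi>' (Suc t) = Suc t}"
proof -
  let ?C = "cond n \<pi> t"
  define below where "below \<rho> u = {s. s \<le> t \<and> \<rho> s < \<rho> u}" for \<rho> :: "nat \<Rightarrow> nat" and u
  define R where "R c = {\<rho> \<in> ?C. card (below \<rho> (Suc t)) = c}" for c
  have fin: "finite (below \<rho> u)" for \<rho> u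
    by (simp add: below_def)
  have tn: "t < n" using assms by simp
  have same: "below \<rho> s = below \<pi> s" if "\<rho> \<in> ?C" "s \<le> t" for \<rho> s
    using cond_less_iff[OF that(1) _ that(2) tn] by (auto simp: below_def)
  \<comment> \<open>The ranks of the old awards among themselves are distinct, hence exhaust
    \<open>{..t}\<close>. So each \<open>c \<le> t\<close> is the rank of some old award
    \<open>x\<close>, the swap partner of the new award in passing from \<open>c\<close> to
    \<open>Suc c\<close>.\<close>
  have "inj_on (\<lambda>s. card (below \<pi> s)) {..t}"
  proof (rule inj_onI, rule ccontr)
    fix s s' assume *: "s \<in> {..t}" "s' \<in> {..t}" "card (below \<pi> s) = card (below \<pi> s')" "s \<noteq> s'"
    have "below \<pi> s \<subset> below \<pi> s' \<or> below \<pi> s' \<subset> below \<pi> s"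
    proof (cases "\<pi> s < \<pi> s'")
      case True
      then have "s \<in> below \<pi> s' - below \<pi> s" "below \<pi> s \<subseteq> below \<pi> s'"
        using * by (auto simp: below_def)
      then show ?thesis by blast
    next
      case False
      then have "\<pi> s' < \<pi> s" using perms_inj[OF assms(1)] *(4) by (metis linorder_neqE_nat)
      then have "s' \<in> below \<pi> s - below \<pi> s'" "below \<pi> s' \<subseteq> below \<pi> s"
        using * by (auto simp: below_def)
      then show ?thesis by blast
    qed
    then show False
      using psubset_card_mono[OF fin, of "below \<pi> s" \<pi> s'] psubset_card_mono[OF fin, of "below \<pi> s'" \<pi> s] *(3)
      by auto
  qed
  moreover have "(\<lambda>s. card (below \<pi> s)) ` {..t} \<subseteq> {..t}"
  proof clarsimp
    fix s assume "s \<le> t"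
    then have "below \<pi> s \<subset> {..t}" by (auto simp: below_def)
    then have "card (below \<pi> s) < card {..t}" by (rule psubset_card_mono[rotated]) simp
    then show "card (below \<pi> s) \<le> t" by simp
  qed
  ultimately have surj: "(\<lambda>s. card (below \<pi> s)) ` {..t} = {..t}"
    by (intro endo_inj_surj) auto
  have step: "card (R c) = card (R (Suc c))" if "c \<le> t" for c
  proof -
    obtain x where x: "x \<le> t" "card (below \<pi> x) = c"
    proof -
      have "c \<in> (\<lambda>s. card (below \<pi> s)) ` {..t}"
        using \<open>c \<le> t\<close> unfolding surj by simp
      then show thesis
        using that by blast
    qed
    define g where "g = transpose (Suc t) x"
    have gg: "(\<rho> \<circ> g) \<circ> g = \<rho>" for \<rho> :: "nat \<Rightarrow> nat"
      by (simp add: g_def fun_eq_iff)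
    have gp: "\<rho> \<circ> g \<in> perms n" if "\<rho> \<in> perms n" for \<rho>
    proof -
      have "g permutes {..<n}"
        unfolding g_def using x assms by (intro permutes_swap_id) auto
      then show ?thesis
        using that permutes_compose unfolding perms_def by auto
    qed
    have gx: "g x = Suc t" "g (Suc t) = x" by (auto simp: g_def)
    have gs: "g s = s" if "s \<le> t" "s \<noteq> x" for s
      using that by (simp add: g_def)
    text \<open>Both ranks \<open>c\<close> and \<open>c + 1\<close> pin down which old awards lie below the new one.\<close>
    have Rc: "below \<rho> (Suc t) = below \<pi> x" if "\<rho> \<in> R c" for \<rho>
    proof -
      have \<rho>: "\<rho> \<in> ?C" and card: "card (below \<rho> (Suc t)) = c" using that by (auto simp: R_def)
      \<comment> \<open>Both are initial segments of one linear order, hence nested; equal size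
        makes them equal.\<close>
      have "below \<rho> (Suc t) \<subseteq> below \<rho> x \<or> below \<rho> x \<subseteq> below \<rho> (Suc t)"
        by (auto simp: below_def)
      then have "below \<rho> (Suc t) = below \<rho> x"
        using card x(2) same[OF \<rho> x(1)] card_subset_eq[OF fin] by metis
      then show ?thesis using same[OF \<rho> x(1)] by simp
    qed
    have RS: "below \<rho> (Suc t) = insert x (below \<pi> x)" if "\<rho> \<in> R (Suc c)" for \<rho>
    proof -
      have \<rho>: "\<rho> \<in> ?C" and card: "card (below \<rho> (Suc t)) = Suc c" using that by (auto simp: R_def)
      have "x \<notin> below \<pi> x" by (simp add: below_def)
      then have cx: "card (insert x (below \<rho> x)) = Suc c" using x(2) fin same[OF \<rho> x(1)] by simp
      have "below \<rho> (Suc t) \<subseteq> insert x (below \<rho> x) \<or> insert x (below \<rho> x) \<subseteq> below \<rho> (Suc t)"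
      proof (cases "\<rho> x < \<rho> (Suc t)")
        case True
        then show ?thesis using x(1) by (auto simp: below_def)
      next
        case False
        then show ?thesis by (auto simp: below_def)
      qed
      then have "below \<rho> (Suc t) = insert x (below \<rho> x)"
        using card cx card_subset_eq[OF fin, of "insert x (below \<rho> x)" \<rho> "Suc t"]
          card_subset_eq[of "insert x (below \<rho> x)" "below \<rho> (Suc t)"] fin by auto
      then show ?thesis using same[OF \<rho> x(1)] by simp
    qed
    \<comment> \<open>The swap is invisible up to round \<open>t\<close> provided that no other old
      award lies between \<open>x\<close> and the new one.\<close>
    have condI: "\<rho> \<circ> g \<in> ?C"
      if "\<rho> \<in> ?C" and iff: "\<And>s. s \<le> t \<Longrightarrow> s \<noteq> x \<Longrightarrow> \<rho> s < \<rho> (Suc t) \<longleftrightarrow> \<rho> s < \<rho> x" for \<rho>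
    proof -
      have \<rho>p: "\<rho> \<in> perms n" using that cond_subset_perms by blast
      have ne: "\<rho> s \<noteq> \<rho> (Suc t)" "\<rho> s \<noteq> \<rho> x" if "s \<le> t" "s \<noteq> x" for s
        using perms_inj[OF \<rho>p] that by auto
      have "(\<rho> \<circ> g) s < (\<rho> \<circ> g) s' \<longleftrightarrow> \<rho> s < \<rho> s'" if ss: "s \<le> t" "s' \<le> t" for s s'
      proof -
        consider "s = x" "s' = x" | "s = x" "s' \<noteq> x" | "s \<noteq> x" "s' = x" | "s \<noteq> x" "s' \<noteq> x"
          by blast
        then show ?thesis
        proof cases
          case 2
          then show ?thesis using gx gs[of s'] ne[of s'] iff[of s'] ss by (simp, linarith)
        next
          case 3
          then show ?thesis using gx gs[of s] iff[of s] ss by simp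
        qed (use ss gs in auto)
      qed
      then have "obs n (\<rho> \<circ> g) t = obs n \<rho> t"
        unfolding obs_def by (auto simp del: o_apply)
      then show ?thesis using gp[OF \<rho>p] that(1) by (simp add: cond_def)
    qed
    have "bij_betw (\<lambda>\<rho>. \<rho> \<circ> g) (R c) (R (Suc c))"
    proof (rule bij_betwI[where g = "\<lambda>\<rho>. \<rho> \<circ> g"])
      show "(\<lambda>\<rho>. \<rho> \<circ> g) \<in> R c \<rightarrow> R (Suc c)"
      proof
        fix \<rho> assume \<rho>: "\<rho> \<in> R c"
        then have \<rho>C: "\<rho> \<in> ?C" by (simp add: R_def)
        have b: "below \<rho> (Suc t) = below \<rho> x" using Rc[OF \<rho>] same[OF \<rho>C x(1)] by simp
        have iff: "\<rho> s < \<rho> (Suc t) \<longleftrightarrow> \<rho> s < \<rho> x" if "s \<le> t" for s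
          using b that by (auto simp: below_def)
        have lt: "\<rho> (Suc t) < \<rho> x"
          using iff[OF x(1)] perms_inj[OF subsetD[OF cond_subset_perms \<rho>C], of x "Suc t"] x(1)
          by (cases "\<rho> x < \<rho> (Suc t)") (auto simp: not_less le_less)
        have C: "\<rho> \<circ> g \<in> ?C" by (rule condI[OF \<rho>C iff])
        have "below (\<rho> \<circ> g) (Suc t) = insert x (below \<rho> x)"
        proof (rule set_eqI)
          fix s show "s \<in> below (\<rho> \<circ> g) (Suc t) \<longleftrightarrow> s \<in> insert x (below \<rho> x)"
            using gx gs[of s] x(1) lt by (cases "s = x") (auto simp: below_def)
        qed
        moreover have "card (insert x (below \<rho> x)) = Suc c"
          using x same[OF \<rho>C x(1)] fin by (simp add: below_def)
        ultimately show "\<rho> \<circ> g \<in> R (Suc c)" using C by (simp add: R_def)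
      qed
      show "(\<lambda>\<rho>. \<rho> \<circ> g) \<in> R (Suc c) \<rightarrow> R c"
      proof
        fix \<rho> assume \<rho>: "\<rho> \<in> R (Suc c)"
        then have \<rho>C: "\<rho> \<in> ?C" by (simp add: R_def)
        have b: "below \<rho> (Suc t) = insert x (below \<rho> x)" using RS[OF \<rho>] same[OF \<rho>C x(1)] by simp
        have iff: "\<rho> s < \<rho> (Suc t) \<longleftrightarrow> \<rho> s < \<rho> x" if "s \<le> t" "s \<noteq> x" for s
          using b that by (auto simp: below_def)
        have lt: "\<rho> x < \<rho> (Suc t)" using b by (auto simp: below_def)
        have C: "\<rho> \<circ> g \<in> ?C" by (rule condI[OF \<rho>C iff])
        have "below (\<rho> \<circ> g) (Suc t) = below \<rho> x"
        proof (rule set_eqI)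
          fix s show "s \<in> below (\<rho> \<circ> g) (Suc t) \<longleftrightarrow> s \<in> below \<rho> x"
            using gx gs[of s] x(1) lt by (cases "s = x") (auto simp: below_def)
        qed
        then show "\<rho> \<circ> g \<in> R c" using C x same[OF \<rho>C x(1)] by (simp add: R_def)
      qed
    qed (use gg in auto)
    then show ?thesis by (rule bij_betw_same_card)
  qed
  \<comment> \<open>The \<open>t + 2\<close> rank classes \<open>R 0\<close>, ...,
    \<open>R (Suc t)\<close> have equal size, and the top one is the event of a record.\<close>
  have all: "card (R c) = card (R (Suc t))" if "c \<le> Suc t" for c
    using that by (induction rule: inc_induct) (simp_all add: step)
  have bnd: "card (below \<rho> (Suc t)) \<le> Suc t" for \<rho>
  proof -
    have "card (below \<rho> (Suc t)) \<le> card {..t}"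
      by (rule card_mono) (auto simp: below_def)
    then show ?thesis by simp
  qed
  have UN: "?C = (\<Union>c\<in>{..Suc t}. R c)"
    using bnd by (auto simp: R_def)
  have "card ?C = (\<Sum>c\<in>{..Suc t}. card (R c))"
    unfolding UN by (rule card_UN_disjoint) (auto simp: R_def finite_cond)
  also have "\<dots> = (\<Sum>c\<in>{..Suc t}. card (R (Suc t)))"
    by (rule sum.cong[OF refl], rule all) simp
  also have "\<dots> = (t + 2) * card (R (Suc t))"
    by simp
  also have "R (Suc t) = {\<rho> \<in> ?C. bst \<rho> (Suc t) = Suc t}"
  proof -
    have "card (below \<rho> (Suc t)) = Suc t \<longleftrightarrow> bst \<rho> (Suc t) = Suc t" if "\<rho> \<in> ?C" for \<rho>
    proof -
      have \<rho>p: "\<rho> \<in> perms n" using that cond_subset_perms by blast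
      have "card (below \<rho> (Suc t)) = Suc t \<longleftrightarrow> below \<rho> (Suc t) = {..t}"
      proof
        assume "card (below \<rho> (Suc t)) = Suc t"
        then show "below \<rho> (Suc t) = {..t}"
          by (intro card_subset_eq) (simp_all add: below_def subset_iff)
      qed simp
      also have "\<dots> \<longleftrightarrow> (\<forall>s\<le>t. \<rho> s < \<rho> (Suc t))"
        by (auto simp: below_def)
      also have "\<dots> \<longleftrightarrow> \<rho> (bst \<rho> t) < \<rho> (Suc t)"
        using bst_le[of \<rho> t] bst_greatest[of _ t \<rho>] le_less_trans by blast
      also have "\<dots> \<longleftrightarrow> bst \<rho> (Suc t) = Suc t"
        using bst_le[of \<rho> t] by auto
      finally show ?thesis .
    qed
    then show ?thesis by (auto simp: R_def)
  qed
  finally show ?thesis .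
qed

text \<open>By \<open>card_record\<close> a record has conditional probability
  \<open>1 / (t + 2)\<close> whatever the past, so a quantity that depends on the next round only
  through this event has a two-point average.\<close>

lemma expect_record:
  assumes "\<pi> \<in> perms n" "Suc t < n"
  shows "expect n \<pi> t (\<lambda>\<pi>'. if bst \<pi>' (Suc t) = Suc t then x else y)
    = (x + (real t + 1) * y) / (real t + 2)"
proof -
  let ?C = "cond n \<pi> t" and ?R = "{\<pi>' \<in> cond n \<pi> t. bst \<pi>' (Suc t) = Suc t}"
  have eq: "real (card ?C) = (real t + 2) * real (card ?R)"
    using card_record[OF assms] by (metis of_nat_add of_nat_mult of_nat_numeral)
  then have R: "real (card ?R) \<noteq> 0"
    using card_cond_pos[OF assms(1), of t] by (metis mult_zero_right of_nat_0_eq_iff less_irrefl)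
  have "?C \<inter> - {\<pi>'. bst \<pi>' (Suc t) = Suc t} = ?C - ?R"
    by blast
  moreover have "real (card (?C - ?R)) = real (card ?C) - real (card ?R)"
    by (subst card_Diff_subset) (auto simp: finite_cond card_mono of_nat_diff)
  ultimately have "(\<Sum>\<pi>'\<in>?C. if bst \<pi>' (Suc t) = Suc t then x else y)
      = real (card ?R) * x + (real (card ?C) - real (card ?R)) * y"
    by (simp add: sum.If_cases[OF finite_cond] Int_def del: bst.simps)
  also have "\<dots> = real (card ?R) * (x + (real t + 1) * y)"
    unfolding eq by (simp add: algebra_simps)
  finally show ?thesis
    unfolding expect_def eq using R by (simp del: bst.simps)
qed

text \<open>Backwards from the last round, where the best award seen is the overall maximum.
  Earlier, the current best survives the next arrival with probability
  \<open>(t + 1) / (t + 2)\<close>, and this factor turns \<open>(t + 2) / n\<close> into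
  \<open>(t + 1) / n\<close>.\<close>

lemma expect_best:
  assumes "\<pi> \<in> perms n" "t < n" "b \<le> t"
  shows "expect n \<pi> t (\<lambda>\<pi>'. if \<pi>' b = n - 1 then 1 else 0)
    = (if b = bst \<pi> t then (real t + 1) / real n else 0)"
  using assms
proof (induction "n - Suc t" arbitrary: t \<pi>)
  case 0
  then have t: "t = n - 1" and n: "0 < n" by auto
  have "(if \<pi>' b = n - 1 then 1 else 0) = (if b = bst \<pi> t then 1 else (0::real))"
    if "\<pi>' \<in> cond n \<pi> t" for \<pi>'
  proof -
    have \<pi>': "\<pi>' \<in> perms n" using that cond_subset_perms by blast
    have "\<pi>' b = n - 1 \<longleftrightarrow> b = bst \<pi>' t"
      using bst_last[OF \<pi>' n] perms_inj[OF \<pi>'] t by metis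
    then show ?thesis
      using bst_cond[OF 0(2) that 0(3)] by simp
  qed
  then have "expect n \<pi> t (\<lambda>\<pi>'. if \<pi>' b = n - 1 then 1 else 0)
      = expect n \<pi> t (\<lambda>_. if b = bst \<pi> t then 1 else 0)"
    by (rule expect_cong)
  also have "\<dots> = (if b = bst \<pi> t then 1 else 0)"
    by (rule expect_const[OF 0(2)])
  finally have "expect n \<pi> t (\<lambda>\<pi>'. if \<pi>' b = n - 1 then 1 else 0)
      = (if b = bst \<pi> t then 1 else 0)" .
  then show ?case
    using t n by (simp add: of_nat_diff)
next
  case (Suc m)
  then have St: "Suc t < n" by simp
  let ?f = "\<lambda>\<pi>'. if \<pi>' b = n - 1 then 1 else (0::real)"
  let ?y = "if b = bst \<pi> t then (real t + 2) / real n else 0"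
  have "expect n \<pi> t ?f = expect n \<pi> t (\<lambda>\<pi>'. expect n \<pi>' (Suc t) ?f)"
    by (rule expect_tower[symmetric])
  also have "\<dots> = expect n \<pi> t (\<lambda>\<pi>'. if bst \<pi>' (Suc t) = Suc t then 0 else ?y)"
  proof (rule expect_cong)
    fix \<pi>' assume \<pi>': "\<pi>' \<in> cond n \<pi> t"
    then have p: "\<pi>' \<in> perms n" using cond_subset_perms by blast
    have "expect n \<pi>' (Suc t) ?f = (if b = bst \<pi>' (Suc t) then (real (Suc t) + 1) / real n else 0)"
      using Suc p by auto
    moreover have "bst \<pi>' t = bst \<pi> t" using bst_cond[OF Suc(3) \<pi>'] Suc by simp
    ultimately show "expect n \<pi>' (Suc t) ?f = (if bst \<pi>' (Suc t) = Suc t then 0 else ?y)"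
      using Suc(5) bst_le[of \<pi> t] by (auto simp: algebra_simps)
  qed
  also have "\<dots> = (0 + (real t + 1) * ?y) / (real t + 2)"
    by (rule expect_record[OF Suc(3) St])
  also have "\<dots> = (if b = bst \<pi> t then (real t + 1) / real n else 0)"
    by simp
  finally show ?case .
qed

section \<open>The values of the continuation games\<close>

text \<open>For decreasing \<open>V\<close> this is term \<open>r\<close> of the decreasing sequence
  formed by inserting \<open>a\<close>: \<open>V r\<close> before the insertion point, then
  \<open>a\<close>, then the shifted terms \<open>V (r - 1)\<close>.\<close>

definition ins :: "real \<Rightarrow> (nat \<Rightarrow> real) \<Rightarrow> nat \<Rightarrow> real" where
  "ins a V r = max (V r) (if r = 0 then a else min a (V (r - 1)))"

text \<open>The second argument counts the awards still to come, so with
  \<open>Suc d \<le> n\<close> of them left the next has index \<open>t = n - Suc d\<close>. It is a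
  record with probability \<open>1 / (t + 1) = 1 / (n - d)\<close>, which explains the
  weights.\<close>

fun val :: "nat \<Rightarrow> nat \<Rightarrow> nat \<Rightarrow> real" where
  "val n 0 r = 0"
| "val n (Suc d) r =
    (real (n - Suc d) * val n d r + ins (real (n - d) / real n) (val n d) r) / real (n - d)"

text \<open>The same values indexed by the round: \<open>cont n t\<close> is
  \<open>V\<^sub>t\<close>, taken before award \<open>t\<close> is revealed.\<close>

definition cont :: "nat \<Rightarrow> nat \<Rightarrow> nat \<Rightarrow> real" where
  "cont n t = val n (n - t)"

lemma cont_end: "n \<le> t \<Longrightarrow> cont n t r = 0"
  by (simp add: cont_def)

lemma cont_rec:
  assumes "t < n"
  shows "cont n t r = (real t * cont n (Suc t) r + ins ((real t + 1) / real n) (cont n (Suc t)) r)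
    / (real t + 1)"
proof -
  obtain d where d: "n - t = Suc d" "n - Suc t = d" "n - Suc d = t" "n - d = Suc t"
    using assms by (metis Suc_diff_Suc diff_Suc_Suc diff_diff_cancel less_imp_le_nat Suc_leI)
  have "cont n (Suc t) = val n d" by (simp add: cont_def d)
  then show ?thesis
    using d by (simp add: cont_def add.commute)
qed

lemma ins_ge: "V r \<le> ins a V r"
  by (simp add: ins_def)

lemma ins_antimono:
  assumes "antimono V"
  shows "antimono (ins a V)"
proof (rule antimonoI)
  fix r s :: nat assume "r \<le> s"
  then have "V s \<le> V r" "r \<noteq> 0 \<Longrightarrow> V (s - 1) \<le> V (r - 1)" "r < s \<Longrightarrow> V (s - 1) \<le> V r"
    using assms by (auto simp: antimono_def)
  then show "ins a V s \<le> ins a V r"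
    using \<open>r \<le> s\<close> by (cases "r = s") (auto simp: ins_def)
qed

lemma val_antimono_nonneg: "antimono (val n d) \<and> (\<forall>r. 0 \<le> val n d r)"
proof (induction d)
  case 0
  then show ?case by (simp add: antimono_def)
next
  case (Suc d)
  have "val n (Suc d) s \<le> val n (Suc d) r" if "r \<le> s" for r s
  proof -
    have "val n d s \<le> val n d r" using Suc that by (auto simp: antimono_def)
    moreover have "ins a (val n d) s \<le> ins a (val n d) r" for a
      using ins_antimono[of "val n d"] Suc that by (auto simp: antimono_def)
    ultimately show ?thesis
      unfolding val.simps by (intro divide_right_mono add_mono mult_left_mono) auto
  qed
  moreover have "0 \<le> val n (Suc d) r" for r
  proof -
    have "0 \<le> ins a (val n d) r" for a
      using Suc ins_ge[of "val n d" r a] by (meson order_trans)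
    then show ?thesis
      unfolding val.simps using Suc by (intro divide_nonneg_nonneg add_nonneg_nonneg mult_nonneg_nonneg) auto
  qed
  ultimately show ?case by (auto simp: antimono_def)
qed

lemma cont_antimono: "antimono (cont n t)"
  and cont_nonneg: "0 \<le> cont n t r"
  using val_antimono_nonneg by (auto simp: cont_def)

text \<open>\<open>V\<^sub>t\<close> is an average of \<open>V\<^sub>t\<^sub>+\<^sub>1\<close> and
  its insertion, the larger of the two. This is what makes passing harmless while the best award
  stays free.\<close>

lemma cont_le_ins: "t < n \<Longrightarrow> cont n t r \<le> ins ((real t + 1) / real n) (cont n (Suc t)) r"
  using mult_left_mono[OF ins_ge[of "cont n (Suc t)" r "(real t + 1) / real n"], of "real t"]
  by (simp add: cont_rec field_simps)

lemma ins_last: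
  assumes "t = n - 1" "0 < n"
  shows "ins ((real t + 1) / real n) (cont n (Suc t)) r = (if r = 0 then 1 else 0)"
proof -
  have "(real t + 1) / real n = 1" using assms by (simp add: of_nat_diff)
  moreover have "cont n (Suc t) = (\<lambda>_. 0)" using assms by (auto simp: cont_end fun_eq_iff)
  ultimately show ?thesis by (simp add: ins_def)
qed

section \<open>One round of competition\<close>

definition num_above :: "nat set \<Rightarrow> nat \<Rightarrow> nat" where
  "num_above A i = card {x \<in> A. x < i}"

lemma num_above_mono: "finite A \<Longrightarrow> i \<le> j \<Longrightarrow> num_above A i \<le> num_above A j"
  unfolding num_above_def by (rule card_mono) auto

lemma num_above_cong: "(\<And>x. x < i \<Longrightarrow> x \<in> A \<longleftrightarrow> x \<in> B) \<Longrightarrow> num_above A i = num_above B i"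
  unfolding num_above_def by (rule arg_cong[where f = card]) auto

text \<open>An agent who leaves with a worthless award must have had no prospects either; then all
  agents ranked below her have none, and her departure does not change their values.\<close>

lemma values_after_worthless_leaving:
  assumes fin: "finite B" and sub: "B' \<subseteq> B" and V: "antimono V" "\<And>r. 0 \<le> V r"
    and stay: "\<And>x. x \<in> B' \<Longrightarrow> P x = V (num_above B' x)"
    and leave: "\<And>l. l \<in> B - B' \<Longrightarrow> P l = 0"
    and hopeless: "\<And>l. l \<in> B - B' \<Longrightarrow> (\<And>x. x \<in> B \<Longrightarrow> x < l \<Longrightarrow> x \<in> B') \<Longrightarrow> V (num_above B' l) \<le> 0"
    and i: "i \<in> B"
  shows "P i = V (num_above B i)"
proof (cases "{l \<in> B - B'. l \<le> i} = {}")
  case True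
  then have "num_above B' i = num_above B i"
    using sub by (intro num_above_cong) (metis (mono_tags, lifting) DiffI empty_Collect_eq less_imp_le subsetD)
  moreover have "i \<in> B'" using True i by blast
  ultimately show ?thesis using stay by simp
next
  case False
  \<comment> \<open>\<open>l\<close> is the highest-ranked leaver. Nobody above her leaves, so her
    position in \<open>B'\<close> is that in \<open>B\<close>; hopelessness, monotonicity and
    nonnegativity make \<open>V\<close> vanish from that position on, which covers
    \<open>i\<close>.\<close>
  define l where "l = Min {l \<in> B - B'. l \<le> i}"
  have finL: "finite {l \<in> B - B'. l \<le> i}" using fin by simp
  have l: "l \<in> B - B'" "l \<le> i" using Min_in[OF finL False] by (auto simp: l_def)
  have least: "x \<in> B'" if "x \<in> B" "x < l" for x
  proof (rule ccontr)
    assume "x \<notin> B'"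
    then have "l \<le> x" unfolding l_def using that l by (intro Min_le[OF finL]) auto
    then show False using that by simp
  qed
  have ab: "num_above B' l = num_above B l"
    using sub least by (intro num_above_cong) blast
  have V0: "V r = 0" if "num_above B' l \<le> r" for r
    using hopeless[OF l(1) least] V that by (metis antimonoD order_trans order_antisym)
  have "V (num_above B i) = 0"
    using V0 num_above_mono[OF fin l(2)] ab by simp
  moreover have "P i = 0"
  proof (cases "i \<in> B'")
    case True
    then show ?thesis
      using stay V0 num_above_mono[OF finite_subset[OF sub fin] l(2)] by simp
  next
    case False
    then show ?thesis using leave i by simp
  qed
  ultimately show ?thesis by simp
qed

text \<open>The taker \<open>j\<close> sits exactly at the insertion point. Agents above her keep
  their positions and are worth at least \<open>a\<close>; she gets \<open>a\<close>, which lies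
  between \<open>V\<close> at her position and \<open>V\<close> just before it; agents below move up
  one place, to values of at most \<open>a\<close>.\<close>

lemma values_with_taker:
  assumes fin: "finite A" and V: "antimono V" and j: "j \<in> A"
    and others: "\<And>i. i \<in> A \<Longrightarrow> i \<noteq> j \<Longrightarrow> P i = V (num_above (A - {j}) i)"
    and higher: "\<And>i. i \<in> A \<Longrightarrow> i < j \<Longrightarrow> a \<le> P i"
    and taker: "P j = a" "V (num_above A j) \<le> a"
    and i: "i \<in> A"
  shows "P i = ins a V (num_above A i)"
proof (rule linorder_cases[of i j])
  assume "i < j"
  then have "num_above (A - {j}) i = num_above A i" by (intro num_above_cong) auto
  then have "P i = V (num_above A i)" "a \<le> P i" using others[OF i] higher[OF i] \<open>i < j\<close> by auto
  then show ?thesis by (auto simp: ins_def)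
next
  assume ij: "i = j"
  show ?thesis
  proof (cases "num_above A j")
    case 0
    then show ?thesis using ij taker by (simp add: ins_def)
  next
    case (Suc q)
    let ?S = "{x \<in> A. x < j}"
    have ne: "?S \<noteq> {}" "finite ?S"
      using Suc fin unfolding num_above_def by (metis card.empty nat.distinct(1), simp)
    \<comment> \<open>\<open>x\<close> is the agent directly above \<open>j\<close>. She keeps
      position \<open>q\<close> and is worth at least \<open>a\<close>, so
      \<open>a \<le> V q\<close> and the minimum in \<open>ins\<close> is \<open>a\<close>.\<close>
    define x where "x = Max ?S"
    have x: "x \<in> A" "x < j" using Max_in[OF ne(2,1)] by (auto simp: x_def)
    have "y \<le> x" if "y \<in> ?S" for y using Max_ge[OF ne(2) that] by (simp add: x_def)
    then have "?S = insert x {y \<in> A. y < x}" using x by (auto simp: order.order_iff_strict)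
    then have "card ?S = Suc (card {y \<in> A. y < x})" using fin by simp
    then have "num_above A x = q" using Suc by (simp add: num_above_def)
    moreover have "num_above (A - {j}) x = num_above A x" using x by (intro num_above_cong) auto
    ultimately have "a \<le> V q" using others[of x] higher[of x] x by auto
    then show ?thesis using ij taker Suc by (simp add: ins_def)
  qed
next
  assume ij: "j < i"
  then have "{x \<in> A. x < i} = insert j {x \<in> A - {j}. x < i}" using j by auto
  then have S: "num_above A i = Suc (num_above (A - {j}) i)" using fin by (simp add: num_above_def)
  have "num_above A j \<le> num_above (A - {j}) i"
    unfolding num_above_def using fin ij by (intro card_mono) auto
  then have "V (num_above (A - {j}) i) \<le> a" by (rule order_trans[OF antimonoD[OF V] taker(2)])
  moreover have "V (num_above A i) \<le> V (num_above (A - {j}) i)" using V S by (simp add: antimonoD)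
  moreover have "P i = V (num_above (A - {j}) i)" using others i ij by simp
  ultimately show ?thesis by (simp add: ins_def S)
qed

section \<open>Values of the agents in terms of the state\<close>

definition active :: "nat \<Rightarrow> (nat \<Rightarrow> nat option) \<Rightarrow> nat set" where
  "active k al = {x \<in> {1..k}. al x = None}"

text \<open>\<open>b\<close> is the best award revealed up to round \<open>t\<close>, and \<open>av\<close> says whether it can still be
  taken.\<close>

definition state_value ::
    "nat \<Rightarrow> nat \<Rightarrow> nat \<Rightarrow> (nat \<Rightarrow> nat option) \<Rightarrow> nat \<Rightarrow> bool \<Rightarrow> nat \<Rightarrow> real" where
  "state_value n k t al b av i = (case al i of
      None \<Rightarrow> (if av then ins ((real t + 1) / real n) (cont n (Suc t)) else cont n (Suc t))
                (num_above (active k al) i)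
    | Some c \<Rightarrow> if c = b then (real t + 1) / real n else 0)"

text \<open>Value just after the actions of round \<open>t\<close> when the best award
  \<open>b\<close> is no longer free: an active agent has to wait for a later record, the holder of
  \<open>b\<close> must hope that none comes.\<close>

definition next_value ::
    "nat \<Rightarrow> nat \<Rightarrow> nat \<Rightarrow> (nat \<Rightarrow> nat option) \<Rightarrow> nat \<Rightarrow> nat \<Rightarrow> real" where
  "next_value n k t al b i = (case al i of
      None \<Rightarrow> cont n (Suc t) (num_above (active k al) i)
    | Some c \<Rightarrow> if c = b then (real t + 1) / real n else 0)"

lemma finite_active: "finite (active k al)"
  by (simp add: active_def)

text \<open>The chance that a held award is the maximum is a martingale: \<open>(t + 2) / n\<close>
  if no record comes, an event of probability \<open>(t + 1) / (t + 2)\<close>, and 0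
  otherwise.\<close>

lemma expect_state_value_inactive:
  assumes "\<pi> \<in> perms n" "Suc t < n" "al i = Some c" "c \<le> t"
  shows "expect n \<pi> t (\<lambda>\<pi>'. state_value n k (Suc t) al (bst \<pi>' (Suc t)) (av \<pi>') i)
    = next_value n k t al (bst \<pi> t) i"
proof -
  let ?y = "if c = bst \<pi> t then (real t + 2) / real n else 0"
  have "expect n \<pi> t (\<lambda>\<pi>'. state_value n k (Suc t) al (bst \<pi>' (Suc t)) (av \<pi>') i)
    = expect n \<pi> t (\<lambda>\<pi>'. if bst \<pi>' (Suc t) = Suc t then 0 else ?y)"
  proof (rule expect_cong)
    fix \<pi>' assume "\<pi>' \<in> cond n \<pi> t"
    then have "bst \<pi>' t = bst \<pi> t" using bst_cond[OF assms(1)] assms(2) by simp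
    then show "state_value n k (Suc t) al (bst \<pi>' (Suc t)) (av \<pi>') i
        = (if bst \<pi>' (Suc t) = Suc t then 0 else ?y)"
      using assms bst_le[of \<pi> t] by (auto simp: state_value_def)
  qed
  also have "\<dots> = (0 + (real t + 1) * ?y) / (real t + 2)"
    by (rule expect_record[OF assms(1,2)])
  finally show ?thesis
    using assms(3) by (simp add: next_value_def)
qed

text \<open>With the old best out of reach, the next best award is free exactly if it is new;
  averaging over this event is the recursion \<open>cont_rec\<close>.\<close>

lemma expect_state_value:
  assumes "\<pi> \<in> perms n" "Suc t < n" "\<And>c. al i = Some c \<Longrightarrow> c \<le> t"
    and av: "\<And>\<pi>'. \<pi>' \<in> cond n \<pi> t \<Longrightarrow> av \<pi>' \<longleftrightarrow> bst \<pi>' (Suc t) = Suc t"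
  shows "expect n \<pi> t (\<lambda>\<pi>'. state_value n k (Suc t) al (bst \<pi>' (Suc t)) (av \<pi>') i)
    = next_value n k t al (bst \<pi> t) i"
proof (cases "al i")
  case None
  let ?r = "num_above (active k al) i" and ?V = "cont n (Suc (Suc t))" and ?a = "(real (Suc t) + 1) / real n"
  have "expect n \<pi> t (\<lambda>\<pi>'. state_value n k (Suc t) al (bst \<pi>' (Suc t)) (av \<pi>') i)
    = expect n \<pi> t (\<lambda>\<pi>'. if bst \<pi>' (Suc t) = Suc t then ins ?a ?V ?r else ?V ?r)"
    using None by (intro expect_cong) (simp add: state_value_def av del: bst.simps)
  also have "\<dots> = (ins ?a ?V ?r + (real t + 1) * ?V ?r) / (real t + 2)"
    by (rule expect_record[OF assms(1,2)])
  also have "\<dots> = cont n (Suc t) ?r"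
    using cont_rec[OF assms(2)] by (simp add: add.commute)
  finally show ?thesis using None by (simp add: next_value_def)
next
  case (Some c)
  then show ?thesis
    using expect_state_value_inactive assms by blast
qed

text \<open>If the best award is surely free at the next round, every outcome gives the insertion
  value, which dominates \<open>cont\<close> by \<open>cont_le_ins\<close>.\<close>

lemma expect_state_value_available:
  assumes "\<pi> \<in> perms n" "Suc t < n" "al i = None" and av: "\<And>\<pi>'. \<pi>' \<in> cond n \<pi> t \<Longrightarrow> av \<pi>'"
  shows "next_value n k t al b i
    \<le> expect n \<pi> t (\<lambda>\<pi>'. state_value n k (Suc t) al (bst \<pi>' (Suc t)) (av \<pi>') i)"
proof -
  let ?r = "num_above (active k al) i"
  let ?c = "ins ((real (Suc t) + 1) / real n) (cont n (Suc (Suc t))) ?r"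
  have "expect n \<pi> t (\<lambda>\<pi>'. state_value n k (Suc t) al (bst \<pi>' (Suc t)) (av \<pi>') i)
    = expect n \<pi> t (\<lambda>\<pi>'. ?c)"
    by (intro expect_cong) (simp add: state_value_def av assms(3) del: bst.simps)
  also have "\<dots> = ?c" by (rule expect_const[OF assms(1)])
  finally show ?thesis
    using cont_le_ins[OF assms(2), of ?r] assms(3) by (simp add: next_value_def)
qed

section \<open>Deferred selections\<close>

lemma d_alloc_Nil: "d_alloc n k [] = (\<lambda>_. None)"
  by (simp add: d_alloc_def)

lemma d_alloc_snoc: "d_alloc n k (h @ [a]) = d_step n k (length h) (d_alloc n k h) a"
  by (simp add: d_alloc_def)

text \<open>Masking only erases actions that \<open>d_step\<close> ignores, so a round can be
  evaluated on the raw joint action.\<close>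

lemma d_alloc_mask:
  "d_alloc n k (h @ [d_mask n k h J]) = d_step n k (length h) (d_alloc n k h) J"
  unfolding d_alloc_snoc d_step_def d_mask_def
  by (auto simp: fun_eq_iff split: option.splits)

lemma d_step_Some: "al i = Some c \<Longrightarrow> d_step n k t al J i = Some c"
  by (simp add: d_step_def)

lemma d_step_new:
  assumes "al i = None" "d_step n k t al J i = Some c"
  shows "i \<in> {1..k}" "J i = Some c" "c \<le> t" "c < n" "\<And>x. al x \<noteq> Some c"
    "\<And>x. 1 \<le> x \<Longrightarrow> x < i \<Longrightarrow> al x = None \<Longrightarrow> J x \<noteq> Some c"
  using assms unfolding d_step_def by (auto split: option.splits if_splits)

lemma d_stepI:
  assumes "al i = None" "i \<in> {1..k}" "J i = Some c" "c \<le> t" "c < n" "\<And>x. al x \<noteq> Some c"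
    and "\<And>x. 1 \<le> x \<Longrightarrow> x < i \<Longrightarrow> al x = None \<Longrightarrow> J x \<noteq> Some c"
  shows "d_step n k t al J i = Some c"
  using assms unfolding d_step_def by auto

text \<open>Ties favour the higher rank, so what an agent receives ignores everybody below her.
  Hence a deviation changes nothing for the agents above the deviator.\<close>

lemma d_step_cong: "(\<And>x. x \<le> i \<Longrightarrow> J x = J' x) \<Longrightarrow> d_step n k t al J i = d_step n k t al J' i"
  unfolding d_step_def by (auto split: option.splits)

lemma d_step_pass: "J i = None \<Longrightarrow> d_step n k t al J i = al i"
  unfolding d_step_def by auto

text \<open>The least active index that selects \<open>c\<close> meets no competition from above.
  Used contrapositively: a free award that nobody obtains was selected by nobody.\<close>

lemma d_step_selected:
  assumes "al i = None" "i \<in> {1..k}" "J i = Some c" "c \<le> t" "c < n" "\<And>x. al x \<noteq> Some c"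
  shows "\<exists>j\<in>active k al. d_step n k t al J j = Some c"
proof -
  let ?P = "\<lambda>j. 1 \<le> j \<and> al j = None \<and> J j = Some c"
  define j where "j = (LEAST j. ?P j)"
  have P: "?P j" unfolding j_def by (rule LeastI[of ?P i]) (use assms in auto)
  have "j \<le> i" unfolding j_def by (rule Least_le) (use assms in auto)
  have "J x \<noteq> Some c" if "1 \<le> x" "x < j" "al x = None" for x
    using not_less_Least[of x ?P] that unfolding j_def by blast
  then have "d_step n k t al J j = Some c"
    using P \<open>j \<le> i\<close> assms by (intro d_stepI) auto
  then show ?thesis
    using P \<open>j \<le> i\<close> assms(2) by (auto simp: active_def)
qed

lemma d_alloc_range: "d_alloc n k h i = Some c \<Longrightarrow> i \<in> {1..k} \<and> c < n \<and> c < length h"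
proof (induction h rule: rev_induct)
  case (snoc a h)
  then show ?case
    using d_step_new[of "d_alloc n k h" i n k "length h" a c]
    by (cases "d_alloc n k h i") (auto simp: d_alloc_snoc d_step_Some)
qed (simp add: d_alloc_Nil)

lemma d_alloc_inj: "d_alloc n k h i = Some c \<Longrightarrow> d_alloc n k h i' = Some c \<Longrightarrow> i = i'"
proof (induction h arbitrary: i i' rule: rev_induct)
  case (snoc a h)
  let ?al = "d_alloc n k h"
  have S: "d_step n k (length h) ?al a i = Some c" "d_step n k (length h) ?al a i' = Some c"
    using snoc.prems by (simp_all add: d_alloc_snoc)
  have new: "?al x \<noteq> Some c" "a y = Some c" "y \<in> {1..k}"
      "\<And>x. 1 \<le> x \<Longrightarrow> x < y \<Longrightarrow> ?al x = None \<Longrightarrow> a x \<noteq> Some c"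
    if "?al y = None" "d_step n k (length h) ?al a y = Some c" for x y
    using d_step_new[OF that] by auto
  have old: "?al x = None \<or> ?al x = Some c" if "d_step n k (length h) ?al a x = Some c" for x
    using that d_step_Some[of ?al x] by (cases "?al x") auto
  show ?case
  proof (cases "?al i = None")
    case True
    then have "?al i' = None" using old[OF S(2)] new(1)[OF True S(1)] by auto
    then show ?thesis
      using True new(2-4)[OF True S(1)] new(2-4)[OF _ S(2)] by (cases i i' rule: linorder_cases) auto
  next
    case False
    then have "?al i = Some c" using old[OF S(1)] by auto
    moreover from this have "?al i' = Some c" using old[OF S(2)] new(1)[OF _ S(2)] by auto
    ultimately show ?thesis by (rule snoc.IH)
  qed
qed (simp add: d_alloc_Nil)

lemma length_d_ext: "length (d_ext n k \<sigma> \<pi> h m) = length h + m"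
  by (induction m) (simp_all add: Let_def)

text \<open>\<open>d_ext\<close> appends rounds at the end; peeling off the first one instead moves
  play into the next subgame.\<close>

lemma d_ext_Suc:
  "d_ext n k \<sigma> \<pi> h (Suc m)
    = d_ext n k \<sigma> \<pi> (h @ [d_mask n k h (\<lambda>i. \<sigma> i (obs n \<pi> (length h)) h)]) m"
  by (induction m) (simp_all add: Let_def)

lemma d_ext_cong:
  assumes "\<And>h' i Ob. length h \<le> length h' \<Longrightarrow> \<sigma> i Ob h' = \<sigma>' i Ob h'"
  shows "d_ext n k \<sigma> \<pi> h m = d_ext n k \<sigma>' \<pi> h m"
  by (induction m) (simp_all add: Let_def assms length_d_ext)

lemma d_alloc_d_ext: "d_alloc n k h i = Some c \<Longrightarrow> d_alloc n k (d_ext n k \<sigma> \<pi> h m) i = Some c"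
  by (induction m) (simp_all add: Let_def d_alloc_snoc d_step_Some)

lemma d_final_step:
  assumes "length h < n + k"
  shows "d_final n k \<sigma> \<pi> h
    = d_final n k \<sigma> \<pi> (h @ [d_mask n k h (\<lambda>i. \<sigma> i (obs n \<pi> (length h)) h)])"
proof -
  have "n + k - length h = Suc (n + k - Suc (length h))" using assms by simp
  then show ?thesis by (simp add: d_final_def d_ext_Suc del: d_ext.simps)
qed

lemma d_valid_snoc:
  assumes "d_valid n k h" "Suc (length h) < n + k"
  shows "d_valid n k (h @ [d_mask n k h J])"
proof -
  have "d_mask n k h (d_mask n k h J) = d_mask n k h J" by (auto simp: d_mask_def)
  then show ?thesis
    using assms by (auto simp: d_valid_def nth_append less_Suc_eq)
qed

section \<open>Winning probabilities and one-shot deviations in the deferred game\<close>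

lemma d_pay_expect:
  "d_pay n k \<sigma> \<pi> h i m
    = expect n \<pi> (length h) (\<lambda>\<pi>'. if d_rank k \<pi>' (d_final n k \<sigma> \<pi>' h) i = m then 1 else 0)"
  unfolding d_pay_def by (rule expect_indicator[symmetric])

text \<open>All orders in one information class lead to the same joint action, hence to the same
  next history; the rest is the tower property.\<close>

lemma d_pay_step:
  assumes "length h < n + k"
  shows "d_pay n k \<sigma> \<pi> h i m = expect n \<pi> (length h)
    (\<lambda>\<pi>'. d_pay n k \<sigma> \<pi>' (h @ [d_mask n k h (\<lambda>i. \<sigma> i (obs n \<pi> (length h)) h)]) i m)"
proof -
  let ?h = "h @ [d_mask n k h (\<lambda>i. \<sigma> i (obs n \<pi> (length h)) h)]"
  have "d_pay n k \<sigma> \<pi> h i m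
    = expect n \<pi> (length h) (\<lambda>\<pi>'. if d_rank k \<pi>' (d_final n k \<sigma> \<pi>' ?h) i = m then 1 else 0)"
    unfolding d_pay_expect
  proof (rule expect_cong)
    fix \<pi>' assume "\<pi>' \<in> cond n \<pi> (length h)"
    then have "obs n \<pi>' (length h) = obs n \<pi> (length h)" by (simp add: cond_def)
    then show "(if d_rank k \<pi>' (d_final n k \<sigma> \<pi>' h) i = m then 1 else 0)
        = (if d_rank k \<pi>' (d_final n k \<sigma> \<pi>' ?h) i = m then 1 else (0::real))"
      using d_final_step[OF assms, of \<sigma> \<pi>'] by simp
  qed
  then show ?thesis
    unfolding d_pay_expect[of n k \<sigma> _ ?h] using expect_tower by simp
qed

lemma d_pay_cong:
  assumes "\<And>h' i Ob. length h \<le> length h' \<Longrightarrow> \<sigma> i Ob h' = \<sigma>' i Ob h'"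
  shows "d_pay n k \<sigma> \<pi> h i m = d_pay n k \<sigma>' \<pi> h i m"
proof -
  have "d_final n k \<sigma> \<pi>' h = d_final n k \<sigma>' \<pi>' h" for \<pi>'
    unfolding d_final_def by (subst d_ext_cong[of h \<sigma> \<sigma>']) (use assms in auto)
  then show ?thesis by (simp add: d_pay_def)
qed

lemma d_rank_1_unique:
  assumes "\<pi> \<in> perms n" "d_rank k \<pi> (d_alloc n k h) i = 1" "d_rank k \<pi> (d_alloc n k h) i' = 1"
  shows "i = i'"
proof -
  let ?al = "d_alloc n k h"
  have top: "\<exists>c. ?al x = Some c \<and> (\<forall>y c'. ?al y = Some c' \<longrightarrow> \<pi> c' \<le> \<pi> c)"
    if "d_rank k \<pi> ?al x = 1" for x
  proof (cases "?al x")
    case (Some c)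
    let ?S = "{i'. 1 \<le> i' \<and> i' \<le> k \<and> (\<exists>j'. ?al i' = Some j' \<and> \<pi> c < \<pi> j')}"
    have "finite ?S" by (rule finite_subset[of _ "{1..k}"]) auto
    moreover have "card ?S = 0" using that Some by (simp add: d_rank_def)
    ultimately have "?S = {}" by simp
    then have "\<pi> c' \<le> \<pi> c" if "?al y = Some c'" for y c'
      using d_alloc_range[OF that] that by (auto simp: not_less)
    then show ?thesis using Some by blast
  qed (use that in \<open>simp add: d_rank_def\<close>)
  obtain c where c: "?al i = Some c" "\<And>y c'. ?al y = Some c' \<Longrightarrow> \<pi> c' \<le> \<pi> c"
    using top[OF assms(2)] by blast
  obtain c' where c': "?al i' = Some c'" "\<And>y c. ?al y = Some c \<Longrightarrow> \<pi> c \<le> \<pi> c'"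
    using top[OF assms(3)] by blast
  have "\<pi> c = \<pi> c'" using c(2)[OF c'(1)] c'(2)[OF c(1)] by simp
  then have "c = c'" using perms_inj[OF assms(1)] by simp
  then show ?thesis using c(1) c'(1) d_alloc_inj by simp
qed

lemma sum_d_pay_le_1:
  assumes "\<pi> \<in> perms n" "finite A"
  shows "(\<Sum>i\<in>A. d_pay n k \<sigma> \<pi> h i 1) \<le> 1"
proof -
  let ?C = "cond n \<pi> (length h)"
  let ?W = "\<lambda>i. {\<pi>' \<in> ?C. d_rank k \<pi>' (d_final n k \<sigma> \<pi>' h) i = 1}"
  have "(\<Sum>i\<in>A. card (?W i)) = card (\<Union>i\<in>A. ?W i)"
  proof (rule card_UN_disjoint[symmetric])
    show "\<forall>i\<in>A. \<forall>j\<in>A. i \<noteq> j \<longrightarrow> ?W i \<inter> ?W j = {}"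
    proof (intro ballI impI equals0I)
      fix i j \<pi>' assume "i \<noteq> j" "\<pi>' \<in> ?W i \<inter> ?W j"
      then show False
        using d_rank_1_unique[of \<pi>' n k _ i j] cond_subset_perms unfolding d_final_def by blast
    qed
  qed (simp_all add: assms(2) finite_cond)
  also have "\<dots> \<le> card ?C"
    by (rule card_mono[OF finite_cond]) auto
  finally have "real (\<Sum>i\<in>A. card (?W i)) \<le> real (card ?C)"
    by (rule of_nat_mono)
  then show ?thesis
    unfolding d_pay_def of_nat_sum sum_divide_distrib[symmetric]
    by (rule divide_le_eq_1_pos[THEN iffD2, rotated]) (use card_cond_pos[OF assms(1)] in simp)
qed

lemma d_pay_nonneg: "0 \<le> d_pay n k \<sigma> \<pi> h i m"
  by (simp add: d_pay_def)

lemma d_pay_others_0: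
  assumes "\<pi> \<in> perms n" "d_pay n k \<sigma> \<pi> h j 1 \<ge> 1" "i \<noteq> j"
  shows "d_pay n k \<sigma> \<pi> h i 1 = 0"
  using sum_d_pay_le_1[OF assms(1), of "{i, j}" k \<sigma> h] assms(2,3) d_pay_nonneg[of n k \<sigma> \<pi> h i 1]
  by simp

lemma d_pay_holder:
  assumes \<pi>: "\<pi> \<in> perms n" and "0 < n" and al: "d_alloc n k h i = Some b"
    and best: "\<And>\<pi>'. \<pi>' \<in> cond n \<pi> (length h) \<Longrightarrow> \<pi>' b = n - 1"
  shows "d_pay n k \<sigma> \<pi> h i 1 = 1"
proof -
  have "d_rank k \<pi>' (d_final n k \<sigma> \<pi>' h) i = 1" if \<pi>': "\<pi>' \<in> cond n \<pi> (length h)" for \<pi>'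
  proof -
    let ?al = "d_final n k \<sigma> \<pi>' h"
    have "?al i = Some b" unfolding d_final_def by (rule d_alloc_d_ext[OF al])
    moreover have "{i'. 1 \<le> i' \<and> i' \<le> k \<and> (\<exists>j'. ?al i' = Some j' \<and> \<pi>' b < \<pi>' j')} = {}"
    proof (intro equals0I, clarify)
      fix x c assume "?al x = Some c" "\<pi>' b < \<pi>' c"
      then have "c < n" "n \<le> \<pi>' c" using best[OF \<pi>'] \<open>0 < n\<close> d_alloc_range unfolding d_final_def by auto
      moreover have "\<pi>' \<in> perms n" using \<pi>' cond_subset_perms by blast
      ultimately show False using perms_less[of \<pi>' n c] by simp
    qed
    ultimately show ?thesis by (simp add: d_rank_def)
  qed
  then have "{\<pi>' \<in> cond n \<pi> (length h). d_rank k \<pi>' (d_final n k \<sigma> \<pi>' h) i = 1} = cond n \<pi> (length h)"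
    by blast
  then show ?thesis
    using card_cond_pos[OF \<pi>, of "length h"] by (simp add: d_pay_def)
qed

text \<open>The deviation \<open>\<tau>\<close> differs from the equilibrium strategy only at
  history \<open>h\<close>. Later histories are longer, so the continuation payoffs are those of
  \<open>\<sigma>\<close>.\<close>

lemma d_spe_one_shot:
  assumes spe: "d_spe n k \<sigma>" and n: "0 < n" and \<pi>: "\<pi> \<in> perms n" and h: "d_valid n k h"
    and i: "i \<in> {1..k}"
  defines "J \<equiv> \<lambda>i. \<sigma> i (obs n \<pi> (length h)) h"
  shows "expect n \<pi> (length h) (\<lambda>\<pi>'. d_pay n k \<sigma> \<pi>' (h @ [d_mask n k h (J(i := c))]) i 1)
    \<le> d_pay n k \<sigma> \<pi> h i 1"
proof -
  define \<tau> where "\<tau> Ob h' = (if h' = h then c else \<sigma> i Ob h')" for Ob h'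
  let ?\<sigma> = "\<sigma>(i := \<tau>)"
  let ?h = "h @ [d_mask n k h (J(i := c))]"
  have len: "length h < n + k" using h by (simp add: d_valid_def)
  have J: "(\<lambda>x. ?\<sigma> x (obs n \<pi> (length h)) h) = J(i := c)"
    by (auto simp: J_def \<tau>_def fun_eq_iff)
  have "d_pay n k ?\<sigma> \<pi> h i 1 = expect n \<pi> (length h) (\<lambda>\<pi>'. d_pay n k ?\<sigma> \<pi>' ?h i 1)"
    using d_pay_step[OF len, of ?\<sigma> \<pi> i 1] unfolding J .
  also have "\<dots> = expect n \<pi> (length h) (\<lambda>\<pi>'. d_pay n k \<sigma> \<pi>' ?h i 1)"
    by (rule expect_cong, rule d_pay_cong) (auto simp: \<tau>_def)
  finally have eq: "d_pay n k ?\<sigma> \<pi> h i 1 = expect n \<pi> (length h) (\<lambda>\<pi>'. d_pay n k \<sigma> \<pi>' ?h i 1)" .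
  have "\<not> lex_less n (d_pay n k \<sigma> \<pi> h i) (d_pay n k ?\<sigma> \<pi> h i)"
    using spe \<pi> h i unfolding d_spe_def by blast
  then have "\<not> d_pay n k \<sigma> \<pi> h i 1 < d_pay n k ?\<sigma> \<pi> h i 1"
    using n unfolding lex_less_def by force
  then show ?thesis using eq by simp
qed

section \<open>Backward induction in the deferred game\<close>

definition d_state :: "nat \<Rightarrow> nat \<Rightarrow> (nat \<Rightarrow> nat) \<Rightarrow> d_jact list \<Rightarrow> nat \<Rightarrow> real" where
  "d_state n k \<pi> h i = state_value n k (length h) (d_alloc n k h) (bst \<pi> (length h))
    (\<forall>x. d_alloc n k h x \<noteq> Some (bst \<pi> (length h))) i"

text \<open>Distinct agents hold distinct awards, so at most \<open>n\<close> agents have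
  left.\<close>

lemma card_active: "k \<le> n + card (active k (d_alloc n k h))"
proof -
  let ?al = "d_alloc n k h"
  let ?L = "{x \<in> {1..k}. ?al x \<noteq> None}"
  have "inj_on (the \<circ> ?al) ?L"
    by (rule inj_onI) (auto intro: d_alloc_inj)
  moreover have "(the \<circ> ?al) ` ?L \<subseteq> {..<n}"
    using d_alloc_range by fastforce
  ultimately have "card ?L \<le> card {..<n}"
    using card_inj_on_le by blast
  moreover have "{1..k} = ?L \<union> active k ?al" "?L \<inter> active k ?al = {}"
    by (auto simp: active_def)
  then have "card {1..k} = card ?L + card (active k ?al)"
    by (metis (no_types, lifting) card_Un_disjoint finite_Un finite_atLeastAtMost)
  ultimately show ?thesis by simp
qed

lemma active_mask:
  "active k (d_alloc n k (h @ [d_mask n k h J])) \<subseteq> active k (d_alloc n k h)"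
  by (auto simp: active_def d_alloc_mask d_step_def)

text \<open>Once all awards are revealed the maximum is known, although selection goes on. Its
  holder wins surely; if it is free, the highest-ranked active agent can select it unopposed, so
  equilibrium gives her 1 and everybody else 0.\<close>

lemma d_pay_last:
  assumes spe: "d_spe n k \<sigma>" and n: "0 < n" "n < k" and \<pi>: "\<pi> \<in> perms n"
    and h: "d_valid n k h" "length h = n - 1" and i: "i \<in> {1..k}"
  shows "d_pay n k \<sigma> \<pi> h i 1 = d_state n k \<pi> h i"
proof -
  define t where "t = length h"
  define b where "b = bst \<pi> t"
  let ?al = "d_alloc n k h"
  have t: "t = n - 1" "t < n" "b \<le> t" using h n bst_le by (auto simp: t_def b_def)
  have best: "\<pi>' b = n - 1" if "\<pi>' \<in> cond n \<pi> t" for \<pi>'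
    using bst_last[of \<pi>' n] bst_cond[OF \<pi> that] t that cond_subset_perms n unfolding b_def by auto
  have others: "d_pay n k \<sigma> \<pi> h x 1 = 0" if "1 \<le> d_pay n k \<sigma> \<pi> h j 1" "x \<noteq> j" for x j
    using d_pay_others_0[OF \<pi> that] .
  have one: "d_pay n k \<sigma> \<pi> h j 1 = 1" if "1 \<le> d_pay n k \<sigma> \<pi> h j 1" for j
    using that sum_d_pay_le_1[OF \<pi>, of "{j}" k \<sigma> h] by simp
  have a: "(real t + 1) / real n = 1" using t n by (simp add: of_nat_diff)
  have state: "d_state n k \<pi> h i = (case ?al i of
      None \<Rightarrow> if (\<forall>x. ?al x \<noteq> Some b) \<and> num_above (active k ?al) i = 0 then 1 else 0
    | Some c \<Rightarrow> if c = b then 1 else 0)"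
    using ins_last[of t n] t n a unfolding d_state_def state_value_def t_def[symmetric] b_def[symmetric]
    by (simp add: cont_end split: option.splits)
  show ?thesis
  proof (cases "\<exists>x. ?al x = Some b")
    case True
    then obtain x where x: "?al x = Some b" by blast
    have "d_pay n k \<sigma> \<pi> h x 1 = 1"
      using d_pay_holder[OF \<pi> n(1) x] best t_def by simp
    then have pay: "d_pay n k \<sigma> \<pi> h i 1 = (if i = x then 1 else 0)"
      using others[of x i] by simp
    show ?thesis
    proof (cases "?al i")
      case None
      then show ?thesis using state pay x by auto
    next
      case (Some c)
      then have "c = b \<longleftrightarrow> i = x" using x d_alloc_inj[OF x, of i] by auto
      then show ?thesis using state pay Some by simp
    qed
  next
    case False
    let ?A = "active k ?al"
    define j where "j = Min ?A"
    have "?A \<noteq> {}" using card_active[of k n h] n by auto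
    then have j: "j \<in> ?A" using Min_in[OF finite_active] by (simp add: j_def)
    have least: "j \<le> x" if "x \<in> ?A" for x using Min_le[OF finite_active that] by (simp add: j_def)
    define J where "J = (\<lambda>i. \<sigma> i (obs n \<pi> t) h)"
    let ?h = "h @ [d_mask n k h (J(j := Some b))]"
    have "d_step n k t ?al (J(j := Some b)) j = Some b"
    proof (rule d_stepI)
      show "(J(j := Some b)) x \<noteq> Some b" if "1 \<le> x" "x < j" "?al x = None" for x
        using least[of x] that j by (auto simp: active_def)
    qed (use j False t in \<open>auto simp: active_def\<close>)
    then have alj: "d_alloc n k ?h j = Some b" by (simp add: d_alloc_mask t_def)
    have "d_pay n k \<sigma> \<pi>' ?h j 1 = 1" if \<pi>': "\<pi>' \<in> cond n \<pi> t" for \<pi>'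
    proof (rule d_pay_holder[OF _ n(1) alj])
      show "\<pi>' \<in> perms n" using \<pi>' cond_subset_perms by blast
      show "\<rho> b = n - 1" if "\<rho> \<in> cond n \<pi>' (length ?h)" for \<rho>
        using best[of \<rho>] that cond_Suc[of n \<pi>' t] cond_eq[OF \<pi>'] by (auto simp: t_def)
    qed
    then have "expect n \<pi> t (\<lambda>\<pi>'. d_pay n k \<sigma> \<pi>' ?h j 1) = expect n \<pi> t (\<lambda>_. 1)"
      by (rule expect_cong)
    also have "\<dots> = 1" by (rule expect_const[OF \<pi>])
    finally have "1 \<le> d_pay n k \<sigma> \<pi> h j 1"
      using d_spe_one_shot[OF spe n(1) \<pi> h(1), of j "Some b"] j unfolding J_def t_def
      by (auto simp: active_def)
    then have pay: "d_pay n k \<sigma> \<pi> h i 1 = (if i = j then 1 else 0)"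
      using one others by auto
    show ?thesis
    proof (cases "?al i")
      case None
      then have iA: "i \<in> ?A" using i by (simp add: active_def)
      have "num_above ?A i = 0 \<longleftrightarrow> i = j"
      proof
        assume "num_above ?A i = 0"
        then have "{x \<in> ?A. x < i} = {}" using finite_active[of k ?al] by (simp add: num_above_def)
        then show "i = j" using j least[OF iA] by auto
      next
        assume "i = j"
        then have "{x \<in> ?A. x < i} = {}" using least by fastforce
        then show "num_above ?A i = 0" unfolding num_above_def by simp
      qed
      then show ?thesis using state pay None False by simp
    next
      case (Some c)
      then show ?thesis using state pay False j by (auto simp: active_def)
    qed
  qed
qed

text \<open>\<open>Q K x\<close> is what \<open>x\<close> gets if joint action \<open>K\<close> is
  played now and the equilibrium afterwards. One-shot deviations to passing and to selecting
  \<open>b\<close> bound the equilibrium values from below; these bounds feed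
  \<open>values_after_worthless_leaving\<close> and \<open>values_with_taker\<close>.\<close>

lemma d_pay_step_state:
  assumes spe: "d_spe n k \<sigma>" and k: "2 * n < k" and \<pi>: "\<pi> \<in> perms n"
    and h: "d_valid n k h" "Suc (length h) < n" and i: "i \<in> {1..k}"
    and IH: "\<And>h' \<pi>' x. d_valid n k h' \<Longrightarrow> length h' = Suc (length h) \<Longrightarrow> \<pi>' \<in> perms n \<Longrightarrow> x \<in> {1..k}
      \<Longrightarrow> d_pay n k \<sigma> \<pi>' h' x 1 = d_state n k \<pi>' h' x"
  shows "d_pay n k \<sigma> \<pi> h i 1 = d_state n k \<pi> h i"
proof -
  define t where "t = length h"
  define b where "b = bst \<pi> t"
  define al where "al = d_alloc n k h"
  define a where "a = (real t + 1) / real n"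
  define V where "V = cont n (Suc t)"
  define P where "P x = d_pay n k \<sigma> \<pi> h x 1" for x
  define step where "step = d_step n k t al"
  define hist where "hist J = h @ [d_mask n k h J]" for J
  define Q where "Q J x = expect n \<pi> t (\<lambda>\<pi>'. d_pay n k \<sigma> \<pi>' (hist J) x 1)" for J x
  define J where "J = (\<lambda>i. \<sigma> i (obs n \<pi> t) h)"
  let ?A = "active k al" and ?A' = "active k (step J)"
  have n: "0 < n" and tn: "Suc t < n" "t < n" using h by (auto simp: t_def)
  have bt: "b \<le> t" by (simp add: b_def bst_le)
  have a0: "0 < a" using n by (simp add: a_def)
  have V: "antimono V" "\<And>r. 0 \<le> V r" by (simp_all add: V_def cont_antimono cont_nonneg)
  have alloc_hist: "d_alloc n k (hist K) = step K" for K
    by (simp add: hist_def d_alloc_mask step_def al_def t_def)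
  have inj: "step K x = Some c \<Longrightarrow> step K y = Some c \<Longrightarrow> x = y" for K x y c
    using d_alloc_inj[of n k "hist K"] by (simp add: alloc_hist)
  have rng: "c \<le> t" if "step K x = Some c" for K x c
    using d_alloc_range[of n k "hist K" x c] that by (simp add: alloc_hist) (simp add: hist_def t_def)
  have cond_b: "bst \<pi>' t = b" if "\<pi>' \<in> cond n \<pi> t" for \<pi>'
    using bst_cond[OF \<pi> that tn(2)] by (simp add: b_def)
  have Q_state: "Q K x = expect n \<pi> t (\<lambda>\<pi>'. state_value n k (Suc t) (step K) (bst \<pi>' (Suc t))
      (\<forall>y. step K y \<noteq> Some (bst \<pi>' (Suc t))) x)" if "x \<in> {1..k}" for K x
    unfolding Q_def
  proof (rule expect_cong)
    fix \<pi>' assume "\<pi>' \<in> cond n \<pi> t"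
    then have p: "\<pi>' \<in> perms n" using cond_subset_perms by blast
    have l: "length (hist K) = Suc t" by (simp add: hist_def t_def)
    have v: "d_valid n k (hist K)"
      unfolding hist_def by (rule d_valid_snoc[OF h(1)]) (use h in simp)
    have "d_pay n k \<sigma> \<pi>' (hist K) x 1 = d_state n k \<pi>' (hist K) x"
      by (rule IH[OF v _ p that]) (simp add: l t_def[symmetric])
    then show "d_pay n k \<sigma> \<pi>' (hist K) x 1 = state_value n k (Suc t) (step K) (bst \<pi>' (Suc t))
      (\<forall>y. step K y \<noteq> Some (bst \<pi>' (Suc t))) x"
      unfolding d_state_def l alloc_hist .
  qed
  have Q_taken: "Q K x = next_value n k t (step K) b x" if x: "x \<in> {1..k}" and y: "step K y = Some b" for K x y
    unfolding Q_state[OF x] b_def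
  proof (rule expect_state_value[OF \<pi> tn(1)])
    \<comment> \<open>The old best is gone, and award \<open>Suc t\<close> cannot have been selected
      in round \<open>t\<close>.\<close>
    show "(\<forall>y. step K y \<noteq> Some (bst \<pi>' (Suc t))) \<longleftrightarrow> bst \<pi>' (Suc t) = Suc t"
      if "\<pi>' \<in> cond n \<pi> t" for \<pi>'
      using cond_b[OF that] y rng[of K _ "Suc t"] by fastforce
  qed (rule rng)
  \<comment> \<open>If \<open>b\<close> is still free, the next best award is \<open>b\<close> or
    the new one, both free, so the value is no smaller than with \<open>b\<close> taken.\<close>
  have Q_ge: "next_value n k t (step K) b x \<le> Q K x" if x: "x \<in> {1..k}" and None: "step K x = None" for K x
  proof (cases "\<exists>y. step K y = Some b")
    case True
    then show ?thesis using Q_taken[OF x] by auto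
  next
    case False
    show ?thesis unfolding Q_state[OF x]
    proof (rule expect_state_value_available[where al = "step K" and i = x, OF \<pi> tn(1) None])
      show "\<forall>y. step K y \<noteq> Some (bst \<pi>' (Suc t))" if "\<pi>' \<in> cond n \<pi> t" for \<pi>'
      proof -
        have "bst \<pi>' (Suc t) = b \<or> bst \<pi>' (Suc t) = Suc t" using cond_b[OF that] by simp
        moreover have "step K y \<noteq> Some (Suc t)" for y using rng[of K y "Suc t"] by auto
        ultimately show ?thesis using False by metis
      qed
    qed
  qed
  have Q_inactive: "Q K x = (if c = b then a else 0)" if x: "x \<in> {1..k}" and c: "step K x = Some c" for K x c
  proof -
    have "Q K x = next_value n k t (step K) b x"
      unfolding Q_state[OF x] b_def by (rule expect_state_value_inactive[where al = "step K" and i = x, OF \<pi> tn(1) c rng[OF c]])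
    then show ?thesis using c by (simp add: next_value_def a_def)
  qed
  have P_Q: "P x = Q J x" for x
    using d_pay_step[of h n k \<sigma> \<pi> x 1] h(1)
    by (simp add: P_def Q_def hist_def J_def t_def d_valid_def)
  have dev: "Q (J(x := c)) x \<le> P x" if "x \<in> {1..k}" for x c
    using d_spe_one_shot[OF spe n \<pi> h(1) that, of c]
    by (simp add: P_def Q_def hist_def J_def t_def)
  have P_stay: "P x = V (num_above ?A' x)" if "x \<in> ?A'" "step J y = Some b" for x y
    using Q_taken[of x J y] that by (simp add: P_Q next_value_def V_def active_def)
  have pass_None: "step (J(x := None)) x = None" if "x \<in> ?A" for x
    using d_step_pass[of "J(x := None)" x n k t al] that by (simp add: step_def active_def)
  \<comment> \<open>Passing does not affect the agents above \<open>x\<close>, so she stays active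
    at the position they leave her under \<open>J\<close>.\<close>
  have pass: "V (num_above ?A' x) \<le> P x" if x: "x \<in> ?A" for x
  proof -
    let ?K = "J(x := None)"
    have "num_above (active k (step ?K)) x = num_above ?A' x"
    proof (rule num_above_cong)
      fix y assume "y < x"
      then have "step ?K y = step J y" unfolding step_def by (intro d_step_cong) auto
      then show "y \<in> active k (step ?K) \<longleftrightarrow> y \<in> ?A'" by (simp add: active_def)
    qed
    then have "V (num_above ?A' x) = next_value n k t (step ?K) b x"
      using pass_None[OF x] by (simp add: next_value_def V_def)
    also have "\<dots> \<le> Q ?K x" using x by (intro Q_ge pass_None) (auto simp: active_def)
    also have "\<dots> \<le> P x" using x by (intro dev) (auto simp: active_def)
    finally show ?thesis .
  qed
  have take: "a \<le> P x" if x: "x \<in> ?A" and free: "\<And>y. al y \<noteq> Some b"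
    and higher: "\<And>y. y \<in> ?A \<Longrightarrow> y < x \<Longrightarrow> J y \<noteq> Some b" for x
  proof -
    let ?K = "J(x := Some b)"
    have x': "al x = None" "x \<in> {1..k}" using x by (auto simp: active_def)
    have "step ?K x = Some b"
      unfolding step_def
    proof (rule d_stepI)
      show "?K y \<noteq> Some b" if "1 \<le> y" "y < x" "al y = None" for y
        using that x' higher[of y] by (auto simp: active_def)
    qed (use x' free bt tn in auto)
    then have "Q ?K x = a" using Q_inactive[of x ?K b] x' by simp
    then show ?thesis using dev[OF x'(2), of "Some b"] by simp
  qed
  have leave: "P l = 0" if l: "l \<in> ?A" "l \<notin> ?A'" "step J l \<noteq> Some b" for l
  proof -
    obtain c where "step J l = Some c" using l by (auto simp: active_def)
    then show ?thesis using Q_inactive[of l J c] l by (auto simp: P_Q active_def)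
  qed
  have sub: "?A' \<subseteq> ?A"
    using active_mask[of k n h J] unfolding hist_def[symmetric] alloc_hist al_def .
  have "P i = state_value n k t al b (\<forall>x. al x \<noteq> Some b) i"
  proof (cases "al i")
    case (Some c)
    then have "step J i = Some c" by (simp add: step_def d_step_Some)
    then show ?thesis using Q_inactive[OF i] Some by (simp add: P_Q state_value_def a_def)
  next
    case None
    then have iA: "i \<in> ?A" using i by (simp add: active_def)
    show ?thesis
    proof (cases "\<exists>x. al x = Some b")
      case True
      then obtain y where y: "al y = Some b" by blast
      then have sy: "step J y = Some b" by (simp add: step_def d_step_Some)
      have P0: "P l = 0" if "l \<in> ?A - ?A'" for l
      proof (rule leave)
        show "step J l \<noteq> Some b" using that y inj[OF sy, of l] by (auto simp: active_def)
      qed (use that in auto)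
      have "P i = V (num_above ?A i)"
        using finite_active sub V
      proof (rule values_after_worthless_leaving)
        show "P x = V (num_above ?A' x)" if "x \<in> ?A'" for x by (rule P_stay[OF that sy])
        show "V (num_above ?A' l) \<le> 0" if "l \<in> ?A - ?A'" for l
          using pass[of l] P0[OF that] that by simp
      qed (fact P0 iA)+
      then show ?thesis using None y by (auto simp: state_value_def V_def)
    next
      case False
      then have free: "\<And>x. al x \<noteq> Some b" by simp
      \<comment> \<open>If nobody obtained \<open>b\<close>, nobody selected it, so each active
        agent could have secured \<open>a \<ge> 1 / n\<close>. Winning probabilities sum to at most
        1, so at most \<open>n\<close> agents would be active; but \<open>k > 2 * n\<close> and at
        most \<open>n\<close> have left.\<close>
      have "\<exists>j\<in>?A. step J j = Some b"
      proof (rule ccontr)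
        assume none: "\<not> ?thesis"
        have "J x \<noteq> Some b" if "x \<in> ?A" for x
        proof
          assume "J x = Some b"
          then have "\<exists>j\<in>?A. step J j = Some b"
            unfolding step_def using that free bt tn by (intro d_step_selected) (auto simp: active_def)
          then show False using none by simp
        qed
        then have "a \<le> P x" if "x \<in> ?A" for x using take[OF that free] by blast
        moreover have "1 / real n \<le> a" by (simp add: a_def divide_right_mono)
        ultimately have "real (card ?A) * (1 / real n) \<le> (\<Sum>x\<in>?A. P x)"
          by (intro sum_bounded_below) (meson order_trans)
        also have "\<dots> \<le> 1"
          unfolding P_def by (rule sum_d_pay_le_1[OF \<pi> finite_active])
        finally have "card ?A \<le> n" using n by (simp add: field_simps)
        then show False using card_active[of k n h] k by (simp add: al_def)
      qed
      then obtain j where j: "j \<in> ?A" "step J j = Some b" by blast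
      \<comment> \<open>Since \<open>j\<close> obtained \<open>b\<close>, no active agent above her
        selected it, and each of them could have had it.\<close>
      have higher: "a \<le> P x" if "x \<in> ?A" "x < j" for x
      proof (rule take[OF that(1) free])
        fix y assume "y \<in> ?A" "y < x"
        then show "J y \<noteq> Some b"
          using d_step_new(6)[of al j n k t J b y] j that by (auto simp: active_def step_def)
      qed
      have P0: "P l = 0" if "l \<in> ?A - {j} - ?A'" for l
      proof (rule leave)
        show "step J l \<noteq> Some b" using that inj[OF j(2), of l] by auto
      qed (use that in auto)
      have jA': "j \<notin> ?A'" using j by (simp add: active_def)
      \<comment> \<open>Further agents may leave in the same round with worthless awards, so
        positions in \<open>?A'\<close> have to be traded for positions in
        \<open>?A - {j}\<close>.\<close>
      have others: "P x = V (num_above (?A - {j}) x)" if x: "x \<in> ?A - {j}" for x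
        using _ _ V
      proof (rule values_after_worthless_leaving)
        show "finite (?A - {j})" using finite_active by simp
        show "?A' \<subseteq> ?A - {j}" using sub jA' by blast
        show "P x = V (num_above ?A' x)" if "x \<in> ?A'" for x by (rule P_stay[OF that j(2)])
        show "V (num_above ?A' l) \<le> 0" if "l \<in> ?A - {j} - ?A'" for l
          using pass[of l] P0[OF that] that by simp
      qed (fact P0 x)+
      have "P i = ins a V (num_above ?A i)"
        using finite_active V(1) j(1)
      proof (rule values_with_taker)
        show Pj: "P j = a" using Q_inactive[of j J b] j by (simp add: P_Q active_def)
        \<comment> \<open>An agent above \<open>j\<close> is worth at least \<open>a > 0\<close>,
          whereas leaving with another award is worth 0; so nobody above \<open>j\<close>
          leaves.\<close>
        have "num_above ?A' j = num_above ?A j"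
          using sub P0 higher a0 by (intro num_above_cong) fastforce
        then show "V (num_above ?A j) \<le> a" using pass[OF j(1)] Pj by simp
      qed (use others higher iA in auto)
      then show ?thesis using None False by (simp add: state_value_def V_def a_def)
    qed
  qed
  then show ?thesis by (simp add: P_def d_state_def al_def b_def t_def)
qed

lemma d_pay_eq_state:
  assumes "d_spe n k \<sigma>" "2 * n < k" "\<pi> \<in> perms n" "d_valid n k h" "length h < n" "i \<in> {1..k}"
  shows "d_pay n k \<sigma> \<pi> h i 1 = d_state n k \<pi> h i"
  using assms(3-)
proof (induction "n - Suc (length h)" arbitrary: h \<pi> i)
  case 0
  then show ?case
    using assms(2) by (intro d_pay_last[OF assms(1)]) auto
next
  case (Suc m)
  show ?case
  proof (rule d_pay_step_state[OF assms(1,2) Suc(3,4) _ Suc(6)])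
    show "Suc (length h) < n" using Suc(2) by simp
    show "d_pay n k \<sigma> \<pi>' h' x 1 = d_state n k \<pi>' h' x"
      if "d_valid n k h'" "length h' = Suc (length h)" "\<pi>' \<in> perms n" "x \<in> {1..k}" for h' \<pi>' x
      using Suc(2) that by (intro Suc(1)) auto
  qed
qed

lemma num_above_all: "i \<in> {1..k} \<Longrightarrow> num_above (active k (\<lambda>_. None)) i = i - 1"
proof -
  assume "i \<in> {1..k}"
  then have "{x \<in> active k (\<lambda>_. None). x < i} = {1..<i}" by (auto simp: active_def)
  then show ?thesis by (simp add: num_above_def)
qed

lemma cond_0: "cond n \<pi> 0 = perms n"
  by (auto simp: cond_def obs_def)

lemma id_perms: "id \<in> perms n"
  by (simp add: perms_def permutes_id)

lemma d_win_eq: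
  assumes "d_spe n k \<sigma>" "2 * n < k" "i \<in> {1..k}"
  shows "d_win n k \<sigma> i = cont n 0 (i - 1)"
proof (cases "n = 0")
  case True
  have "d_final n k \<sigma> \<pi> [] i = None" for \<pi>
    using d_alloc_range[of n k _ i] True unfolding d_final_def by (metis not_Some_eq not_less_zero)
  then show ?thesis
    using True by (simp add: d_win_def d_rank_def cont_end)
next
  case False
  have "d_win n k \<sigma> i = d_pay n k \<sigma> id [] i 1"
    by (simp add: d_win_def d_pay_def cond_0)
  also have "\<dots> = d_state n k id [] i"
    using assms False by (intro d_pay_eq_state id_perms) (auto simp: d_valid_def)
  \<comment> \<open>At round 0 the only award is a free record, and the weight of
    \<open>cont n (Suc 0)\<close> in \<open>cont_rec\<close> is 0, so the insertion value is
    \<open>cont n 0\<close>.\<close>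
  also have "\<dots> = cont n 0 (i - 1)"
    using False num_above_all[OF assms(3)]
    by (simp add: d_state_def state_value_def d_alloc_Nil cont_rec)
  finally show ?thesis .
qed

section \<open>Immediate selections\<close>

lemma i_alloc_Nil: "i_alloc n k [] = (\<lambda>_. None)"
  by (simp add: i_alloc_def)

lemma i_alloc_snoc: "i_alloc n k (h @ [a]) = i_step n k (length h) (i_alloc n k h) a"
  by (simp add: i_alloc_def)

lemma i_alloc_mask:
  "i_alloc n k (h @ [i_mask n k h J]) = i_step n k (length h) (i_alloc n k h) J"
  unfolding i_alloc_snoc i_step_def i_mask_def by (auto simp: fun_eq_iff)

lemma i_step_Some: "al i = Some c \<Longrightarrow> i_step n k t al J i = Some c"
  by (simp add: i_step_def)

lemma i_step_new:
  assumes "al i = None" "i_step n k t al J i = Some c"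
  shows "i \<in> {1..k}" "J i" "c = t" "t < n" "\<And>x. 1 \<le> x \<Longrightarrow> x < i \<Longrightarrow> al x = None \<Longrightarrow> \<not> J x"
  using assms unfolding i_step_def by (auto split: if_splits)

lemma i_stepI:
  assumes "al i = None" "i \<in> {1..k}" "J i" "t < n"
    and "\<And>x. 1 \<le> x \<Longrightarrow> x < i \<Longrightarrow> al x = None \<Longrightarrow> \<not> J x"
  shows "i_step n k t al J i = Some t"
  using assms unfolding i_step_def by auto

lemma i_step_cong: "(\<And>x. x \<le> i \<Longrightarrow> J x = J' x) \<Longrightarrow> i_step n k t al J i = i_step n k t al J' i"
  unfolding i_step_def by auto

lemma i_step_reject: "\<not> J i \<Longrightarrow> i_step n k t al J i = al i"
  unfolding i_step_def by auto

lemma i_step_unique: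
  assumes "al i = None" "i_step n k t al J i = Some c" "al j = None" "i_step n k t al J j = Some c'"
  shows "i = j"
  using i_step_new[OF assms(1,2)] i_step_new[OF assms(3,4)] assms(1,3)
  by (cases i j rule: linorder_cases) auto

lemma i_step_accepted:
  assumes "al i = None" "i \<in> {1..k}" "J i" "t < n"
  shows "\<exists>j\<in>active k al. i_step n k t al J j = Some t"
proof -
  let ?P = "\<lambda>j. 1 \<le> j \<and> al j = None \<and> J j"
  define j where "j = (LEAST j. ?P j)"
  have P: "?P j" unfolding j_def by (rule LeastI[of ?P i]) (use assms in auto)
  have "j \<le> i" unfolding j_def by (rule Least_le) (use assms in auto)
  have "\<not> J x" if "1 \<le> x" "x < j" "al x = None" for x
    using not_less_Least[of x ?P] that unfolding j_def by blast
  then have "i_step n k t al J j = Some t"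
    using P \<open>j \<le> i\<close> assms by (intro i_stepI) auto
  then show ?thesis
    using P \<open>j \<le> i\<close> assms(2) by (auto simp: active_def)
qed

lemma i_alloc_range: "i_alloc n k h i = Some c \<Longrightarrow> c < n \<and> c < length h"
proof (induction h rule: rev_induct)
  case (snoc a h)
  then show ?case
    using i_step_new[of "i_alloc n k h" i n k "length h" a c]
    by (cases "i_alloc n k h i") (auto simp: i_alloc_snoc i_step_Some)
qed (simp add: i_alloc_Nil)

lemma length_i_ext: "length (i_ext n k \<sigma> \<pi> h m) = length h + m"
  by (induction m) (simp_all add: Let_def)

lemma i_ext_Suc:
  "i_ext n k \<sigma> \<pi> h (Suc m)
    = i_ext n k \<sigma> \<pi> (h @ [i_mask n k h (\<lambda>i. \<sigma> i (obs n \<pi> (length h)) h)]) m"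
  by (induction m) (simp_all add: Let_def)

lemma i_ext_cong:
  assumes "\<And>h' i Ob. length h \<le> length h' \<Longrightarrow> \<sigma> i Ob h' = \<sigma>' i Ob h'"
  shows "i_ext n k \<sigma> \<pi> h m = i_ext n k \<sigma>' \<pi> h m"
  by (induction m) (simp_all add: Let_def assms length_i_ext)

lemma i_alloc_i_ext: "i_alloc n k h i = Some c \<Longrightarrow> i_alloc n k (i_ext n k \<sigma> \<pi> h m) i = Some c"
  by (induction m) (simp_all add: Let_def i_alloc_snoc i_step_Some)

lemma i_final_step:
  assumes "length h < n"
  shows "i_final n k \<sigma> \<pi> h
    = i_final n k \<sigma> \<pi> (h @ [i_mask n k h (\<lambda>i. \<sigma> i (obs n \<pi> (length h)) h)])"
proof -
  have "n - length h = Suc (n - Suc (length h))" using assms by simp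
  then show ?thesis by (simp add: i_final_def i_ext_Suc del: i_ext.simps)
qed

lemma i_valid_snoc:
  assumes "i_valid n k h" "Suc (length h) < n"
  shows "i_valid n k (h @ [i_mask n k h J])"
proof -
  have "i_mask n k h (i_mask n k h J) = i_mask n k h J" by (auto simp: i_mask_def)
  then show ?thesis
    using assms by (auto simp: i_valid_def nth_append less_Suc_eq)
qed

section \<open>Winning probabilities and backward induction in the immediate game\<close>

lemma i_pay_expect:
  "i_pay n k \<sigma> \<pi> h i
    = expect n \<pi> (length h) (\<lambda>\<pi>'. if i_wins n \<pi>' (i_final n k \<sigma> \<pi>' h) i then 1 else 0)"
  unfolding i_pay_def by (rule expect_indicator[symmetric])

lemma i_pay_step:
  assumes "length h < n"
  shows "i_pay n k \<sigma> \<pi> h i = expect n \<pi> (length h)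
    (\<lambda>\<pi>'. i_pay n k \<sigma> \<pi>' (h @ [i_mask n k h (\<lambda>i. \<sigma> i (obs n \<pi> (length h)) h)]) i)"
proof -
  let ?h = "h @ [i_mask n k h (\<lambda>i. \<sigma> i (obs n \<pi> (length h)) h)]"
  have "i_pay n k \<sigma> \<pi> h i
    = expect n \<pi> (length h) (\<lambda>\<pi>'. if i_wins n \<pi>' (i_final n k \<sigma> \<pi>' ?h) i then 1 else 0)"
    unfolding i_pay_expect
  proof (rule expect_cong)
    fix \<pi>' assume "\<pi>' \<in> cond n \<pi> (length h)"
    then have "obs n \<pi>' (length h) = obs n \<pi> (length h)" by (simp add: cond_def)
    then show "(if i_wins n \<pi>' (i_final n k \<sigma> \<pi>' h) i then 1 else 0)
        = (if i_wins n \<pi>' (i_final n k \<sigma> \<pi>' ?h) i then 1 else (0::real))"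
      using i_final_step[OF assms, of k \<sigma> \<pi>'] by simp
  qed
  then show ?thesis
    unfolding i_pay_expect[of n k \<sigma> _ ?h] using expect_tower by simp
qed

lemma i_pay_cong:
  assumes "\<And>h' i Ob. length h \<le> length h' \<Longrightarrow> \<sigma> i Ob h' = \<sigma>' i Ob h'"
  shows "i_pay n k \<sigma> \<pi> h i = i_pay n k \<sigma>' \<pi> h i"
proof -
  have "i_final n k \<sigma> \<pi>' h = i_final n k \<sigma>' \<pi>' h" for \<pi>'
    unfolding i_final_def by (subst i_ext_cong[of h \<sigma> \<sigma>']) (use assms in auto)
  then show ?thesis by (simp add: i_pay_def)
qed

text \<open>Winning means holding the overall maximum, so a holder's payoff is independent of
  further play, and \<open>expect_best\<close> evaluates it without an induction hypothesis.\<close>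

lemma i_pay_inactive:
  assumes "i_alloc n k h i = Some c"
  shows "i_pay n k \<sigma> \<pi> h i = expect n \<pi> (length h) (\<lambda>\<pi>'. if \<pi>' c = n - 1 then 1 else 0)"
  unfolding i_pay_expect i_final_def i_wins_def
  using i_alloc_i_ext[OF assms] by simp

lemma i_pay_end: "n \<le> length h \<Longrightarrow> i_alloc n k h i = None \<Longrightarrow> i_pay n k \<sigma> \<pi> h i = 0"
  by (simp add: i_pay_def i_final_def i_wins_def)

lemma i_spe_one_shot:
  assumes spe: "i_spe n k \<sigma>" and \<pi>: "\<pi> \<in> perms n" and h: "i_valid n k h" and i: "i \<in> {1..k}"
  defines "J \<equiv> \<lambda>i. \<sigma> i (obs n \<pi> (length h)) h"
  shows "expect n \<pi> (length h) (\<lambda>\<pi>'. i_pay n k \<sigma> \<pi>' (h @ [i_mask n k h (J(i := c))]) i)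
    \<le> i_pay n k \<sigma> \<pi> h i"
proof -
  define \<tau> where "\<tau> Ob h' = (if h' = h then c else \<sigma> i Ob h')" for Ob h'
  let ?\<sigma> = "\<sigma>(i := \<tau>)"
  let ?h = "h @ [i_mask n k h (J(i := c))]"
  have len: "length h < n" using h by (simp add: i_valid_def)
  have J: "(\<lambda>x. ?\<sigma> x (obs n \<pi> (length h)) h) = J(i := c)"
    by (auto simp: J_def \<tau>_def fun_eq_iff)
  have "i_pay n k ?\<sigma> \<pi> h i = expect n \<pi> (length h) (\<lambda>\<pi>'. i_pay n k ?\<sigma> \<pi>' ?h i)"
    using i_pay_step[OF len, of k ?\<sigma> \<pi> i] unfolding J .
  also have "\<dots> = expect n \<pi> (length h) (\<lambda>\<pi>'. i_pay n k \<sigma> \<pi>' ?h i)"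
    by (rule expect_cong, rule i_pay_cong) (auto simp: \<tau>_def)
  finally show ?thesis
    using spe \<pi> h i unfolding i_spe_def by metis
qed

text \<open>An award can be had only on arrival, so the best one is obtainable iff it is the current
  one; \<open>d_state\<close> asks instead that nobody holds it.\<close>

definition i_state :: "nat \<Rightarrow> nat \<Rightarrow> (nat \<Rightarrow> nat) \<Rightarrow> i_jact list \<Rightarrow> nat \<Rightarrow> real" where
  "i_state n k \<pi> h i = state_value n k (length h) (i_alloc n k h) (bst \<pi> (length h))
    (bst \<pi> (length h) = length h) i"

text \<open>A rejected award is lost, so the value after the round is exactly
  \<open>next_value\<close>; the last round is included because \<open>cont\<close> is 0 after it. A
  further case arises here: a record that nobody accepts.\<close>

lemma i_pay_step_state:
  assumes spe: "i_spe n k \<sigma>" and \<pi>: "\<pi> \<in> perms n" and h: "i_valid n k h" and i: "i \<in> {1..k}"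
    and IH: "\<And>h' \<pi>' x. i_valid n k h' \<Longrightarrow> length h' = Suc (length h) \<Longrightarrow> \<pi>' \<in> perms n \<Longrightarrow> x \<in> {1..k}
      \<Longrightarrow> i_pay n k \<sigma> \<pi>' h' x = i_state n k \<pi>' h' x"
  shows "i_pay n k \<sigma> \<pi> h i = i_state n k \<pi> h i"
proof -
  define t where "t = length h"
  define b where "b = bst \<pi> t"
  define al where "al = i_alloc n k h"
  define a where "a = (real t + 1) / real n"
  define V where "V = cont n (Suc t)"
  define P where "P x = i_pay n k \<sigma> \<pi> h x" for x
  define step where "step = i_step n k t al"
  define hist where "hist J = h @ [i_mask n k h J]" for J
  define Q where "Q J x = expect n \<pi> t (\<lambda>\<pi>'. i_pay n k \<sigma> \<pi>' (hist J) x)" for J x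
  define J where "J = (\<lambda>i. \<sigma> i (obs n \<pi> t) h)"
  let ?A = "active k al" and ?A' = "active k (step J)"
  have tn: "t < n" using h by (auto simp: t_def i_valid_def)
  have V: "antimono V" "\<And>r. 0 \<le> V r" by (simp_all add: V_def cont_antimono cont_nonneg)
  have l: "length (hist K) = Suc t" for K by (simp add: hist_def t_def)
  have alloc_hist: "i_alloc n k (hist K) = step K" for K
    by (simp add: hist_def i_alloc_mask step_def al_def t_def)
  have rng: "c \<le> t" if "step K x = Some c" for K x c
    using i_alloc_range[of n k "hist K" x c] that by (simp add: alloc_hist l)
  have Q: "Q K x = next_value n k t (step K) b x" if x: "x \<in> {1..k}" for K x
  proof (cases "step K x")
    case (Some c)
    have "Q K x = expect n \<pi> t (\<lambda>\<pi>'. expect n \<pi>' (Suc t) (\<lambda>\<pi>''. if \<pi>'' c = n - 1 then 1 else 0))"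
      using i_pay_inactive[of n k "hist K" x c] Some by (simp add: Q_def alloc_hist l)
    also have "\<dots> = (if c = b then a else 0)"
      unfolding expect_tower b_def a_def by (rule expect_best[OF \<pi> tn rng[OF Some]])
    finally show ?thesis using Some by (simp add: next_value_def a_def)
  next
    case None
    show ?thesis
    proof (cases "Suc t < n")
      case True
      have v: "i_valid n k (hist K)"
        unfolding hist_def by (rule i_valid_snoc[OF h]) (use True in \<open>simp add: t_def\<close>)
      have "Q K x = expect n \<pi> t (\<lambda>\<pi>'. state_value n k (Suc t) (step K) (bst \<pi>' (Suc t))
          (bst \<pi>' (Suc t) = Suc t) x)"
        unfolding Q_def
      proof (rule expect_cong)
        fix \<pi>' assume "\<pi>' \<in> cond n \<pi> t"
        then have p: "\<pi>' \<in> perms n" using cond_subset_perms by blast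
        have "i_pay n k \<sigma> \<pi>' (hist K) x = i_state n k \<pi>' (hist K) x"
          by (rule IH[OF v _ p x]) (simp add: l t_def[symmetric])
        then show "i_pay n k \<sigma> \<pi>' (hist K) x = state_value n k (Suc t) (step K) (bst \<pi>' (Suc t))
            (bst \<pi>' (Suc t) = Suc t) x"
          unfolding i_state_def l alloc_hist .
      qed
      also have "\<dots> = next_value n k t (step K) b x"
        unfolding b_def by (rule expect_state_value[OF \<pi> True rng refl])
      finally show ?thesis .
    next
      case False
      then have "i_pay n k \<sigma> \<pi>' (hist K) x = 0" for \<pi>'
        using None by (intro i_pay_end) (simp_all add: l alloc_hist)
      then show ?thesis
        using False None by (simp add: Q_def expect_const[OF \<pi>] next_value_def cont_end)
    qed
  qed
  have Q_inactive: "Q K x = (if c = b then a else 0)" if "x \<in> {1..k}" "step K x = Some c" for K x c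
    using Q that by (simp add: next_value_def a_def)
  have P_Q: "P x = Q J x" for x
    using i_pay_step[of h n k \<sigma> \<pi> x] tn by (simp add: P_def Q_def hist_def J_def t_def)
  have dev: "Q (J(x := c)) x \<le> P x" if "x \<in> {1..k}" for x c
    using i_spe_one_shot[OF spe \<pi> h that, of c]
    by (simp add: P_def Q_def hist_def J_def t_def)
  have stay: "P x = V (num_above ?A' x)" if "x \<in> ?A'" for x
    using Q[of x J] that by (simp add: P_Q next_value_def V_def active_def)
  have reject: "V (num_above ?A' x) \<le> P x" if x: "x \<in> ?A" for x
  proof -
    let ?K = "J(x := False)"
    have None: "step ?K x = None"
      using i_step_reject[of ?K x n k t al] x by (simp add: step_def active_def)
    have "num_above (active k (step ?K)) x = num_above ?A' x"
    proof (rule num_above_cong)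
      fix y assume "y < x"
      then have "step ?K y = step J y" unfolding step_def by (intro i_step_cong) auto
      then show "y \<in> active k (step ?K) \<longleftrightarrow> y \<in> ?A'" by (simp add: active_def)
    qed
    then have "V (num_above ?A' x) = Q ?K x"
      using None Q[of x ?K] x by (simp add: next_value_def V_def active_def)
    also have "\<dots> \<le> P x" using x by (intro dev) (auto simp: active_def)
    finally show ?thesis .
  qed
  have accept: "a \<le> P x" if x: "x \<in> ?A" and rec: "b = t"
    and higher: "\<And>y. y \<in> ?A \<Longrightarrow> y < x \<Longrightarrow> \<not> J y" for x
  proof -
    let ?K = "J(x := True)"
    have x': "al x = None" "x \<in> {1..k}" using x by (auto simp: active_def)
    have "step ?K x = Some t"
      unfolding step_def
    proof (rule i_stepI)
      show "\<not> ?K y" if "1 \<le> y" "y < x" "al y = None" for y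
        using that x' higher[of y] by (auto simp: active_def)
    qed (use x' tn in auto)
    then have "Q ?K x = a" using Q_inactive[of x ?K t] x' rec by simp
    then show ?thesis using dev[OF x'(2), of True] by simp
  qed
  have sub: "?A' \<subseteq> ?A"
    by (auto simp: active_def step_def i_step_def)
  have taken: "step J x = Some t" if "x \<in> ?A - ?A'" for x
    using that i_step_new(3)[of al x n k t J] by (auto simp: active_def step_def)
  have "P i = state_value n k t al b (b = t) i"
  proof (cases "al i")
    case (Some c)
    then have "step J i = Some c" by (simp add: step_def i_step_Some)
    then show ?thesis using Q_inactive[OF i] Some by (simp add: P_Q state_value_def a_def)
  next
    case None
    then have iA: "i \<in> ?A" using i by (simp add: active_def)
    show ?thesis
    proof (cases "b = t")
      case False
      \<comment> \<open>Whoever accepts a non-record leaves with an award that is already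
        beaten.\<close>
      have P0: "P l = 0" if "l \<in> ?A - ?A'" for l
        using Q_inactive[OF _ taken[OF that]] that False by (simp add: P_Q active_def)
      have "P i = V (num_above ?A i)"
        using finite_active sub V
      proof (rule values_after_worthless_leaving)
        show "V (num_above ?A' l) \<le> 0" if "l \<in> ?A - ?A'" for l
          using reject[of l] P0[OF that] that by simp
      qed (fact stay P0 iA)+
      then show ?thesis using None False by (simp add: state_value_def V_def)
    next
      case rec: True
      show ?thesis
      proof (cases "\<exists>j\<in>?A. step J j = Some t")
        case True
        then obtain j where j: "j \<in> ?A" "step J j = Some t" by blast
        \<comment> \<open>Only one award is on offer, so \<open>j\<close> is the only agent to
          leave.\<close>
        have A': "?A' = ?A - {j}"
        proof
          have "j \<notin> ?A'" using j by (simp add: active_def)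
          then show "?A' \<subseteq> ?A - {j}" using sub by blast
          show "?A - {j} \<subseteq> ?A'"
          proof (rule subsetI, rule ccontr)
            fix x assume x: "x \<in> ?A - {j}" "x \<notin> ?A'"
            have "step J x = Some t" by (rule taken) (use x in blast)
            then have "j = x"
              using i_step_unique[of al j n k t J t x t] j x by (simp add: step_def active_def)
            then show False using x by blast
          qed
        qed
        have higher: "a \<le> P x" if "x \<in> ?A" "x < j" for x
        proof (rule accept[OF that(1) rec])
          fix y assume "y \<in> ?A" "y < x"
          then show "\<not> J y"
            using i_step_new(5)[of al j n k t J t y] j that by (auto simp: active_def step_def)
        qed
        have "P i = ins a V (num_above ?A i)"
          using finite_active V(1) j(1)
        proof (rule values_with_taker)
          show Pj: "P j = a" using Q_inactive[of j J t] j rec by (simp add: P_Q active_def)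
          have "num_above ?A' j = num_above ?A j"
            unfolding A' by (intro num_above_cong) auto
          then show "V (num_above ?A j) \<le> a" using reject[OF j(1)] Pj by simp
          show "P x = V (num_above (?A - {j}) x)" if "x \<in> ?A" "x \<noteq> j" for x
            using stay[of x] that A' by simp
        qed (use higher iA in auto)
        then show ?thesis using None rec by (simp add: state_value_def V_def a_def)
      next
        case False
        then have A': "?A' = ?A" using sub taken by blast
        have none: "\<not> J y" if "y \<in> ?A" for y
        proof
          assume "J y"
          then have "\<exists>j\<in>?A. step J j = Some t"
            unfolding step_def using that tn by (intro i_step_accepted) (auto simp: active_def)
          then show False using False by contradiction
        qed
        \<comment> \<open>Nobody above \<open>i\<close> accepts, so accepting would have given her
          the record. Thus \<open>a\<close> is at most \<open>V\<close> at her position, and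
          inserting \<open>a\<close> leaves that term unchanged.\<close>
        have "a \<le> P i" using accept[OF iA rec] none by blast
        moreover have "P i = V (num_above ?A i)" using stay iA A' by simp
        ultimately have "P i = ins a V (num_above ?A i)" by (auto simp: ins_def)
        then show ?thesis using None rec by (simp add: state_value_def V_def a_def)
      qed
    qed
  qed
  then show ?thesis by (simp add: P_def i_state_def al_def b_def t_def)
qed

lemma i_pay_eq_state:
  assumes "i_spe n k \<sigma>" "\<pi> \<in> perms n" "i_valid n k h" "i \<in> {1..k}"
  shows "i_pay n k \<sigma> \<pi> h i = i_state n k \<pi> h i"
  using assms(2-)
proof (induction "n - length h" arbitrary: h \<pi> i rule: less_induct)
  case less
  show ?case
  proof (rule i_pay_step_state[OF assms(1) less(2-4)])
    show "i_pay n k \<sigma> \<pi>' h' x = i_state n k \<pi>' h' x"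
      if "i_valid n k h'" "length h' = Suc (length h)" "\<pi>' \<in> perms n" "x \<in> {1..k}" for h' \<pi>' x
      using that less(3) by (intro less(1)) (auto simp: i_valid_def)
  qed
qed

lemma i_win_eq:
  assumes "i_spe n k \<sigma>" "i \<in> {1..k}"
  shows "i_win n k \<sigma> i = cont n 0 (i - 1)"
proof (cases "n = 0")
  case True
  then show ?thesis
    by (simp add: i_win_def i_wins_def i_final_def i_alloc_Nil cont_end)
next
  case False
  have "i_win n k \<sigma> i = i_pay n k \<sigma> id [] i"
    by (simp add: i_win_def i_pay_def cond_0)
  also have "\<dots> = i_state n k id [] i"
    using assms False by (intro i_pay_eq_state id_perms) (auto simp: i_valid_def)
  also have "\<dots> = cont n 0 (i - 1)"
    using False num_above_all[OF assms(2)]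
    by (simp add: i_state_def state_value_def i_alloc_Nil cont_rec)
  finally show ?thesis .
qed

theorem theorem4:
  fixes n i m :: nat
    and \<sigma> :: "nat \<Rightarrow> nat \<Rightarrow> d_strategy"
    and \<tau> :: "nat \<Rightarrow> i_strategy"
  assumes "1 \<le> i" and "i \<le> m"
    and "i_spe n m \<tau>"
    and "\<forall>k. d_spe n k (\<sigma> k)"
  shows "(\<lambda>k. d_win n k (\<sigma> k) i) \<longlonglongrightarrow> i_win n m \<tau> i"
proof (rule tendsto_eventually)
  \<comment> \<open>The bound yields both \<open>2 * n < k\<close> for the counting argument and
    \<open>i \<le> k\<close>; both sides then equal \<open>cont n 0 (i - 1)\<close>.\<close>
  have "d_win n k (\<sigma> k) i = i_win n m \<tau> i" if "2 * n + i < k" for k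
    using assms that d_win_eq[of n k "\<sigma> k" i] i_win_eq[of n m \<tau> i] by simp
  then show "\<forall>\<^sub>F k in sequentially. d_win n k (\<sigma> k) i = i_win n m \<tau> i"
    unfolding eventually_sequentially by (intro exI[of _ "Suc (2 * n + i)"]) simp
qed

end
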